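(* Let $q>0$, let $l\ge0$ be an integer, and let $h$ be a function on $\mathbb{C}$ belonging to $\Lambda_{q,l}'$, i.e. such that $$|\langle h,\psi\rangle|=\left|\int_{\mathbb{C}}h(z)\psi(z)\,d\lambda(z)\right|\le C(h)\|\psi\|_{\Lambda_{q,l}}\quad\text{for all }\psi\in\Lambda_{q,l}.$$ Suppose that $h$ is orthogonal, as a distribution, to all analytic polynomials: $\langle h,z^k\rangle=0$ for $k=0,1,2,\dots$. Then, for any $q_1\in(0,q/e)$, there exists a function $u\in\Lambda_{q_1,l}'$ such that $\bar\partial u=h$ and, moreover, $$\|u\|_{\Lambda_{q_1,l}'}\le C\,\|h\|_{\Lambda_{q,l}'},$$ or, equivalently, $$|\langle u,\psi\rangle|\le C\,\|h\|_{\Lambda_{q,l}'}\,\|\psi\|_{\Lambda_{q_1,l}}\quad\text{for all }\psi\in\Lambda_{q_1,l},$$ with a constant $C$ not depending on $h$ and $\psi$.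
   Context: Here $e=2.718\ldots$ is the base of natural logarithms and $\lambda$ is Lebesgue measure on $\mathbb{C}$. For $q>0$ and an integer $l\ge0$, $\Lambda_{q,l}$ is the Banach space of $C^l$-functions $\psi$ on $\mathbb{C}$ such that $|D^\alpha\psi(z)|=o(e^{q|z|^2})$ as $|z|\to\infty$ for all multi-indices $\alpha$ with $|\alpha|\le l$ (derivatives in the two real coordinates), with the natural norm $\|\psi\|_{\Lambda_{q,l}}=\max_{|\alpha|\le l}\sup_{z\in\mathbb{C}}|D^\alpha\psi(z)|e^{-q|z|^2}$. $\Lambda_{q,l}'$ is the dual Banach space, and $\langle\cdot,\cdot\rangle$ is the (bilinear) action of a functional on a function. A (locally integrable, complex-valued) function $g$ on $\mathbb{C}$ is regarded as an element of $\Lambda_{q,l}'$ when it acts by $\langle g,\psi\rangle=\int_{\mathbb{C}}g\psi\,d\lambda$ and this action is bounded in the norm of $\Lambda_{q,l}$. The operator $\bar\partial=\frac12(\partial_x+i\partial_y)$, $z=x+iy$, is understood in the sense of distributions. *)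

theory Defs
  imports "HOL-Analysis.Analysis" "HOL-Library.Landau_Symbols"
begin

text \<open>The two partial derivatives of a function on the plane, in the real coordinates
  \<open>z = x + \<i> y\<close>; \<open>frechet_derivative\<close> is the derivative over the reals.\<close>

definition partial_x :: "(complex \<Rightarrow> complex) \<Rightarrow> complex \<Rightarrow> complex" where
  "partial_x f z = frechet_derivative f (at z) 1"

definition partial_y :: "(complex \<Rightarrow> complex) \<Rightarrow> complex \<Rightarrow> complex" where
  "partial_y f z = frechet_derivative f (at z) \<i>"

definition multi_deriv :: "nat \<times> nat \<Rightarrow> (complex \<Rightarrow> complex) \<Rightarrow> complex \<Rightarrow> complex" where
  "multi_deriv \<alpha> f = (partial_x ^^ fst \<alpha>) ((partial_y ^^ snd \<alpha>) f)"

definition multi_indices :: "nat \<Rightarrow> (nat \<times> nat) set" where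
  "multi_indices l = {\<alpha>. fst \<alpha> + snd \<alpha> \<le> l}"

fun C_fun :: "nat \<Rightarrow> (complex \<Rightarrow> complex) \<Rightarrow> bool" where
  "C_fun 0 f \<longleftrightarrow> continuous_on UNIV f"
| "C_fun (Suc k) f \<longleftrightarrow>
     (\<forall>z. f differentiable (at z)) \<and> C_fun k (partial_x f) \<and> C_fun k (partial_y f)"

definition Lam :: "real \<Rightarrow> nat \<Rightarrow> (complex \<Rightarrow> complex) set" where
  "Lam q l = {\<psi>. C_fun l \<psi> \<and>
     (\<forall>\<alpha>\<in>multi_indices l.
        multi_deriv \<alpha> \<psi> \<in> o[at_infinity](\<lambda>z. complex_of_real (exp (q * (cmod z)\<^sup>2))))}"

definition Lam_norm :: "real \<Rightarrow> nat \<Rightarrow> (complex \<Rightarrow> complex) \<Rightarrow> real" where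
  "Lam_norm q l \<psi> =
     (MAX \<alpha>\<in>multi_indices l. SUP z. cmod (multi_deriv \<alpha> \<psi> z) * exp (- q * (cmod z)\<^sup>2))"

text \<open>Functionals on \<open>Lam q l\<close> are represented by functions on all of
  \<open>complex \<Rightarrow> complex\<close>; only their values on \<open>Lam q l\<close> matter.\<close>

definition Lam_dual :: "real \<Rightarrow> nat \<Rightarrow> ((complex \<Rightarrow> complex) \<Rightarrow> complex) set" where
  "Lam_dual q l = {T.
     (\<forall>\<phi>\<in>Lam q l. \<forall>\<psi>\<in>Lam q l. T (\<lambda>z. \<phi> z + \<psi> z) = T \<phi> + T \<psi>) \<and>
     (\<forall>c. \<forall>\<psi>\<in>Lam q l. T (\<lambda>z. c * \<psi> z) = c * T \<psi>) \<and>
     (\<exists>C. \<forall>\<psi>\<in>Lam q l. cmod (T \<psi>) \<le> C * Lam_norm q l \<psi>)}"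

definition Lam_dual_norm :: "real \<Rightarrow> nat \<Rightarrow> ((complex \<Rightarrow> complex) \<Rightarrow> complex) \<Rightarrow> real" where
  "Lam_dual_norm q l T = (SUP \<psi>\<in>{\<psi>\<in>Lam q l. Lam_norm q l \<psi> \<le> 1}. cmod (T \<psi>))"

definition pairing :: "(complex \<Rightarrow> complex) \<Rightarrow> (complex \<Rightarrow> complex) \<Rightarrow> complex" where
  "pairing g \<psi> = (LINT z|lebesgue. g z * \<psi> z)"

definition locally_integrable :: "(complex \<Rightarrow> complex) \<Rightarrow> bool" where
  "locally_integrable g \<longleftrightarrow> (\<forall>K. compact K \<longrightarrow> set_integrable lebesgue K g)"

text \<open>A function belongs to the dual space if the functional \<open>pairing g\<close> does. Integrability
  of the products has to be required, since the integral of a non-integrable function is \<open>0\<close>.\<close>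

definition fun_in_dual :: "real \<Rightarrow> nat \<Rightarrow> (complex \<Rightarrow> complex) \<Rightarrow> bool" where
  "fun_in_dual q l g \<longleftrightarrow> locally_integrable g \<and>
     (\<forall>\<psi>\<in>Lam q l. integrable lebesgue (\<lambda>z. g z * \<psi> z)) \<and> pairing g \<in> Lam_dual q l"

definition test_function :: "(complex \<Rightarrow> complex) \<Rightarrow> bool" where
  "test_function \<phi> \<longleftrightarrow> (\<forall>k. C_fun k \<phi>) \<and> compact (closure {z. \<phi> z \<noteq> 0})"

definition dbar :: "(complex \<Rightarrow> complex) \<Rightarrow> complex \<Rightarrow> complex" where
  "dbar \<phi> z = (partial_x \<phi> z + \<i> * partial_y \<phi> z) / 2"

text \<open>The equation \<open>dbar u = h\<close> in the sense of distributions, for locally integrable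
  \<open>u\<close> and \<open>h\<close>.\<close>

definition dbar_distributional :: "(complex \<Rightarrow> complex) \<Rightarrow> (complex \<Rightarrow> complex) \<Rightarrow> bool" where
  "dbar_distributional u h \<longleftrightarrow>
     (\<forall>\<phi>. test_function \<phi> \<longrightarrow> - pairing u (dbar \<phi>) = pairing h \<phi>)"

end

theory Submission
  imports Defs
begin

text \<open>
The solution is the Cauchy transform \<open>u(w) = (1/\<pi>) \<integral> h(z) / (w - z) d\<lambda>(z)\<close>. Pairing \<open>h\<close> with the functions
\<open>exp (a \<bar>z\<bar>\<^sup>2)\<close>, \<open>a < q\<close>, shows that \<open>\<bar>h\<bar> exp (a \<bar>z\<bar>\<^sup>2)\<close> is integrable, so the transform is defined almost
everywhere, and the equation \<open>\<partial>\<close>-bar \<open>u = h\<close> is the transpose of the Cauchy-Pompeiu formula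
(\<open>cauchy_pompeiu\<close>, \<open>cauchy_transform_dbar\<close>).

The point is the estimate of \<open>u\<close> in the dual norm. Here orthogonality enters: for fixed \<open>w\<close> the function
\<open>(exp (b (z - w)) - 1) / (z - w)\<close> is entire in \<open>z\<close> and of exponential type, hence a limit of polynomials that is
dominated in the weight available for \<open>h\<close>, so \<open>h\<close> annihilates it. Therefore the kernel \<open>1 / (z - w)\<close> may be
multiplied by \<open>exp (b (z - w))\<close> for any number \<open>b\<close> depending on \<open>w\<close> (\<open>cauchy_transform_twist\<close>). With
\<open>a = q1\<close>, choose \<open>b = 2 a cnj w\<close>. Then
  \<open>\<bar>exp (2 a cnj w (z - w))\<bar> = exp (a \<bar>z\<bar>\<^sup>2 - a \<bar>w\<bar>\<^sup>2 - a \<bar>z - w\<bar>\<^sup>2)\<close>,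
so that integration of the twisted kernel against a function \<open>\<psi>\<close> of growth \<open>exp (a \<bar>w\<bar>\<^sup>2)\<close> gives a function of
growth \<open>exp (a \<bar>z\<bar>\<^sup>2)\<close>: the weight is transported exactly, and the remaining factor
\<open>exp (- a \<bar>z - w\<bar>\<^sup>2) / \<bar>z - w\<bar>\<close> is integrable in the plane. In the variable \<open>s = z - w\<close> this operator, called
\<open>solve\<close>, is an integral over \<open>\<psi> (z - s)\<close>, so its derivatives in \<open>z\<close> are operators of the same kind applied to
derivatives of \<open>\<psi>\<close>, with extra powers of \<open>s\<close> which the Gaussian absorbs. Induction on the number of derivatives
(\<open>solve_gauss_bounded\<close>) gives its boundedness from \<open>\<Lambda>\<^bsub>q1,l\<^esub>\<close> into \<open>\<Lambda>\<^bsub>q,l\<^esub>\<close>, and the dual estimate for \<open>u\<close>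
follows by transposition (\<open>cauchy_transform_pairing\<close>).

The growth conditions are handled by the predicate \<open>gauss_bounded\<close>. The Cauchy-Pompeiu formula is obtained by
regularizing the kernel to \<open>cnj s / (\<bar>s\<bar>\<^sup>2 + \<epsilon>)\<close>, which is smooth, so that only the vanishing of the integral of
\<open>\<partial>\<close>-bar of a compactly supported function is used before \<open>\<epsilon>\<close> tends to \<open>0\<close>.
\<close>

section \<open>Partial derivatives\<close>

lemma partials_eqI:
  assumes "(f has_derivative D) (at z)"
  shows "partial_x f z = D 1" "partial_y f z = D \<i>"
  using frechet_derivative_at[OF assms] by (simp_all add: partial_x_def partial_y_def)

lemma has_derivative_partials:
  assumes "f differentiable (at z)"
  shows "(f has_derivative (\<lambda>h. Re h *\<^sub>R partial_x f z + Im h *\<^sub>R partial_y f z)) (at z)"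
proof -
  define D where "D = frechet_derivative f (at z)"
  have D: "(f has_derivative D) (at z)"
    using assms unfolding D_def by (simp add: frechet_derivative_works)
  interpret bounded_linear D by (rule has_derivative_bounded_linear[OF D])
  have "D h = Re h *\<^sub>R partial_x f z + Im h *\<^sub>R partial_y f z" for h
  proof -
    have "D h = D (Re h *\<^sub>R 1 + Im h *\<^sub>R \<i>)"
      by (rule arg_cong[where f = D]) (simp add: complex_eq_iff)
    also have "\<dots> = Re h *\<^sub>R D 1 + Im h *\<^sub>R D \<i>"
      by (simp add: add scaleR)
    finally show ?thesis
      by (simp add: partials_eqI[OF D])
  qed
  then show ?thesis
    using D by (metis (no_types, lifting) ext)
qed

lemma linear_combination_partials:
  assumes "f differentiable (at z)" "g differentiable (at z)"
  shows "(\<lambda>z. c * f z + d * g z) differentiable (at z)"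
    and "partial_x (\<lambda>z. c * f z + d * g z) z = c * partial_x f z + d * partial_x g z"
    and "partial_y (\<lambda>z. c * f z + d * g z) z = c * partial_y f z + d * partial_y g z"
proof -
  note D = has_derivative_add[OF has_derivative_mult_right[OF has_derivative_partials[OF assms(1)], of c]
      has_derivative_mult_right[OF has_derivative_partials[OF assms(2)], of d]]
  show "(\<lambda>z. c * f z + d * g z) differentiable (at z)"
    using D by (auto simp: differentiable_def)
  show "partial_x (\<lambda>z. c * f z + d * g z) z = c * partial_x f z + d * partial_x g z"
    "partial_y (\<lambda>z. c * f z + d * g z) z = c * partial_y f z + d * partial_y g z"
    using partials_eqI[OF D] by simp_all
qed

lemma C_fun_continuous: "C_fun k f \<Longrightarrow> continuous_on UNIV f"
  by (cases k) (auto simp: continuous_on_eq_continuous_at differentiable_imp_continuous_within)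

lemma C_fun_Suc_lower: "C_fun (Suc k) f \<Longrightarrow> C_fun k f"
proof (induction k arbitrary: f)
  case 0
  then show ?case using C_fun_continuous[OF 0] by simp
next
  case (Suc k)
  then show ?case by (metis C_fun.simps(2))
qed

lemma C_fun_mono:
  assumes "C_fun k f" "j \<le> k"
  shows "C_fun j f"
  using assms(2,1) by (induction rule: dec_induct) (use C_fun_Suc_lower in blast)+

lemma C_fun_linear_combination:
  assumes "C_fun k f" "C_fun k g"
  shows "C_fun k (\<lambda>z. c * f z + d * g z)"
  using assms
proof (induction k arbitrary: f g)
  case 0
  then show ?case by (auto intro!: continuous_intros)
next
  case (Suc k)
  then have "f differentiable (at z)" "g differentiable (at z)" for z
    by auto
  note L = linear_combination_partials[OF this]
  show ?case
    using Suc L(1) by (simp add: L(2,3)[abs_def])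
qed

lemma multi_deriv_0 [simp]: "multi_deriv (0, 0) f = f"
  by (simp add: multi_deriv_def)

lemma multi_deriv_Suc_y: "multi_deriv (i, Suc j) f = multi_deriv (i, j) (partial_y f)"
  by (simp add: multi_deriv_def funpow_swap1)

lemma multi_deriv_x0: "multi_deriv (Suc i, 0) f = multi_deriv (i, 0) (partial_x f)"
  by (simp add: multi_deriv_def funpow_swap1)

lemma C_fun_multi_deriv:
  assumes "C_fun (i + j + k) f"
  shows "C_fun k (multi_deriv (i, j) f)"
  using assms
proof (induction j arbitrary: f)
  case 0
  then show ?case
  proof (induction i arbitrary: f)
    case (Suc i)
    then show ?case by (simp add: multi_deriv_x0)
  qed simp
next
  case (Suc j)
  then show ?case by (simp add: multi_deriv_Suc_y)
qed

lemma finite_multi_indices: "finite (multi_indices l)"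
  by (rule finite_subset[of _ "{..l} \<times> {..l}"]) (auto simp: multi_indices_def)

lemma multi_indices_0: "(0, 0) \<in> multi_indices l"
  by (simp add: multi_indices_def)

lemma continuous_multi_deriv:
  assumes "C_fun l f" "\<alpha> \<in> multi_indices l"
  shows "continuous_on UNIV (multi_deriv \<alpha> f)"
proof -
  obtain i j where ij: "\<alpha> = (i, j)" "i + j \<le> l"
    using assms(2) by (cases \<alpha>) (auto simp: multi_indices_def)
  then have "C_fun 0 (multi_deriv \<alpha> f)"
    using C_fun_multi_deriv[of i j 0 f] C_fun_mono[OF assms(1)] by simp
  then show ?thesis by simp
qed

lemma multi_deriv_mult:
  assumes "C_fun l f" "\<alpha> \<in> multi_indices l"
  shows "multi_deriv \<alpha> (\<lambda>z. c * f z) = (\<lambda>z. c * multi_deriv \<alpha> f z)"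
proof -
  obtain i j where ij: "\<alpha> = (i, j)" "i + j \<le> l"
    using assms(2) by (cases \<alpha>) (auto simp: multi_indices_def)
  have 1: "partial_x (\<lambda>z. c * f z) = (\<lambda>z. c * partial_x f z)"
    "partial_y (\<lambda>z. c * f z) = (\<lambda>z. c * partial_y f z)"
    if "C_fun (Suc k) f" for k f
    using linear_combination_partials(2,3)[of f _ f c 0] that by (auto simp: fun_eq_iff)
  have "C_fun (i + j) f"
    using C_fun_mono[OF assms(1) ij(2)] .
  then have "multi_deriv (i, j) (\<lambda>z. c * f z) = (\<lambda>z. c * multi_deriv (i, j) f z)"
  proof (induction j arbitrary: f)
    case 0
    then show ?case
    proof (induction i arbitrary: f)
      case (Suc i)
      then have "C_fun (Suc i) f" by simp
      with Suc show ?case by (simp add: multi_deriv_x0 1(1)[OF \<open>C_fun (Suc i) f\<close>])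
    qed simp
  next
    case (Suc j)
    then have "C_fun (Suc (i + j)) f" by simp
    with Suc show ?case by (simp add: multi_deriv_Suc_y 1(2)[OF \<open>C_fun (Suc (i + j)) f\<close>])
  qed
  then show ?thesis by (simp add: ij)
qed

lemma has_vector_derivative_along:
  fixes f :: "complex \<Rightarrow> complex"
  assumes f: "f differentiable (at (c + of_real t * v))"
  shows "((\<lambda>t. f (c + of_real t * v)) has_vector_derivative
           frechet_derivative f (at (c + of_real t * v)) v) (at t within S)"
proof -
  define D where "D = frechet_derivative f (at (c + of_real t * v))"
  have D: "(f has_derivative D) (at (c + of_real t * v))"
    using f by (simp add: D_def frechet_derivative_works)
  interpret D: bounded_linear D by (rule has_derivative_bounded_linear[OF D])
  have sc: "D (of_real s * v) = s *\<^sub>R D v" for s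
    using D.scaleR[of s v] by (simp add: scaleR_conv_of_real)
  have g: "((\<lambda>t. c + of_real t * v) has_derivative (\<lambda>s. of_real s * v)) (at t within S)"
    by (auto intro!: derivative_eq_intros)
  show ?thesis
    using has_derivative_compose[OF g D]
    by (simp add: has_vector_derivative_def sc D_def[symmetric])
qed

text \<open>Schwarz's theorem is needed because the seminorms of \<^term>\<open>Lam q l\<close> only see the derivatives
\<open>\<partial>\<^sub>x\<^sup>i \<partial>\<^sub>y\<^sup>j f\<close> with the factors in this order, while \<^const>\<open>C_fun\<close> and the inductions below meet them in
every order.\<close>

lemma partials_commute:
  assumes f: "C_fun 2 f"
  shows "partial_y (partial_x f) z = partial_x (partial_y f) z"
proof -
  have C: "C_fun (Suc (Suc 0)) f" using f by (simp add: numeral_2_eq_2)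
  have fd: "f differentiable (at z)" for z using C by simp
  have fxd: "partial_x f differentiable (at z)" for z using C by simp
  have fyd: "partial_y f differentiable (at z)" for z using C by simp
  have cfy: "continuous_on UNIV (partial_y f)" using C C_fun_continuous by (meson C_fun.simps(2))
  have cfyx: "continuous_on UNIV (partial_x (partial_y f))" using C by simp
  define p where "p x y = of_real x + of_real y * \<i>" for x y :: real
  have vx: "((\<lambda>x. g (p x y)) has_vector_derivative partial_x g (p x y)) (at x within S)"
    if "\<And>z. g differentiable (at z)" for g x y S
    using has_vector_derivative_along[OF that, where c="of_real y * \<i>" and t=x and v=1 and S=S]
    by (simp add: p_def partial_x_def add.commute)
  have vy: "((\<lambda>y. g (p x y)) has_vector_derivative partial_y g (p x y)) (at y within S)"
    if "\<And>z. g differentiable (at z)" for g x y S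
    using has_vector_derivative_along[OF that, where c="of_real x" and t=y and v="\<i>" and S=S]
    by (simp add: p_def partial_y_def)
  have cp: "continuous_on S (\<lambda>t. p (u t) (v t))" if "continuous_on S u" "continuous_on S v" for S :: "'a::topological_space set" and u v
    unfolding p_def using that by (intro continuous_intros)
  define x0 y0 b where "x0 = Re z" and "y0 = Im z" and "b = Im z - 1"
  have z: "z = p x0 y0" by (simp add: p_def x0_def y0_def complex_eq_iff)
  \<comment> \<open>Recover \<open>f\<close> from \<open>\<partial>\<^sub>y f\<close> on vertical segments, differentiate under this integral in \<open>x\<close>, and
    then in the upper limit. The segment starts at height \<open>b < y0\<close> so that it is not degenerate at \<open>z\<close>.\<close>
  have I1: "integral (cbox b y) (\<lambda>t. partial_y f (p x t)) = f (p x y) - f (p x b)" if "b \<le> y" for x y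
    using fundamental_theorem_of_calculus[OF that vy[OF fd]] by (simp add: integral_unique)
  have I2: "partial_x f (p x0 y) - partial_x f (p x0 b)
      = integral (cbox b y) (\<lambda>t. partial_x (partial_y f) (p x0 t))" if "b \<le> y" for y
  proof -
    have "((\<lambda>x. integral (cbox b y) (\<lambda>t. partial_y f (p x t))) has_vector_derivative
        integral (cbox b y) (\<lambda>t. partial_x (partial_y f) (p x0 t))) (at x0 within UNIV)"
    proof (rule leibniz_rule_vector_derivative)
      show "continuous_on (UNIV \<times> cbox b y) (\<lambda>(x, t). partial_x (partial_y f) (p x t))"
        unfolding split_beta
        by (rule continuous_on_compose2[OF cfyx cp]) (auto intro!: continuous_intros)
      show "(\<lambda>t. partial_y f (p x t)) integrable_on cbox b y" for x
        by (intro integrable_continuous continuous_on_compose2[OF cfy cp]) (auto intro!: continuous_intros)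
    qed (use vx[OF fyd] in auto)
    then have 1: "((\<lambda>x. f (p x y) - f (p x b)) has_vector_derivative
        integral (cbox b y) (\<lambda>t. partial_x (partial_y f) (p x0 t))) (at x0)"
      using I1[OF that] by simp
    have 2: "((\<lambda>x. f (p x y) - f (p x b)) has_vector_derivative
        (partial_x f (p x0 y) - partial_x f (p x0 b))) (at x0)"
      by (intro derivative_intros vx fd)
    show ?thesis using vector_derivative_unique_at[OF 1 2] by simp
  qed
  have 3: "((\<lambda>y. partial_x f (p x0 y) - partial_x f (p x0 b)) has_vector_derivative
      partial_x (partial_y f) (p x0 y0)) (at y0 within {b..y0})"
  proof (rule has_vector_derivative_transform)
    show "((\<lambda>y. integral {b..y} (\<lambda>t. partial_x (partial_y f) (p x0 t))) has_vector_derivative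
      partial_x (partial_y f) (p x0 y0)) (at y0 within {b..y0})"
      by (rule integral_has_vector_derivative)
        (auto simp: b_def y0_def intro!: continuous_on_compose2[OF cfyx cp] continuous_intros)
  qed (use I2 in \<open>auto simp: b_def y0_def\<close>)
  have 4: "((\<lambda>y. partial_x f (p x0 y) - partial_x f (p x0 b)) has_vector_derivative
      (partial_y (partial_x f) (p x0 y0) - 0)) (at y0 within {b..y0})"
    by (intro derivative_intros vy fxd)
  have "at y0 within {b..y0} \<noteq> bot"
    by (simp add: b_def y0_def trivial_limit_within islimpt_Icc)
  from vector_derivative_unique_within[OF this 3 4] show ?thesis by (simp add: z)
qed

lemma multi_deriv_partial_x:
  assumes "C_fun (Suc (i + j)) f"
  shows "multi_deriv (i, j) (partial_x f) = multi_deriv (Suc i, j) f"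
  using assms
proof (induction j arbitrary: f)
  case 0
  then show ?case by (simp add: multi_deriv_x0)
next
  case (Suc j)
  have "C_fun 2 f" by (rule C_fun_mono[OF Suc.prems]) simp
  then have "partial_y (partial_x f) = partial_x (partial_y f)"
    using partials_commute by blast
  then show ?case using Suc by (simp add: multi_deriv_Suc_y)
qed

section \<open>Functions of Gaussian growth\<close>

text \<open>Every power of the modulus is absorbed by an arbitrarily weak Gaussian: one term of the exponential
series already dominates it.\<close>

lemma power_le_exp_square:
  assumes "\<delta> > (0::real)"
  shows "\<exists>K\<ge>0. \<forall>r\<ge>0. r ^ n \<le> K * exp (\<delta> * r\<^sup>2)"
proof -
  define K where "K = 1 + fact n / \<delta> ^ n"
  have "K \<ge> 0" using assms by (simp add: K_def)
  moreover have "r ^ n \<le> K * exp (\<delta> * r\<^sup>2)" if "r \<ge> 0" for r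
  proof -
    have e1: "1 \<le> exp (\<delta> * r\<^sup>2)" using assms by simp
    have "(\<Sum>k\<in>{n}. (\<delta> * r\<^sup>2) ^ k /\<^sub>R fact k) \<le> (\<Sum>k. (\<delta> * r\<^sup>2) ^ k /\<^sub>R fact k)"
      using assms by (intro sum_le_suminf summable_exp_generic) auto
    then have "(\<delta> * r\<^sup>2) ^ n / fact n \<le> exp (\<delta> * r\<^sup>2)"
      by (simp add: exp_def field_simps)
    then have e2: "(r\<^sup>2) ^ n \<le> fact n / \<delta> ^ n * exp (\<delta> * r\<^sup>2)"
      using assms by (simp add: field_simps power_mult_distrib)
    have "r ^ n \<le> 1 + (r\<^sup>2) ^ n"
    proof (cases "r \<le> 1")
      case True
      then have "r ^ n \<le> 1" using that by (simp add: power_le_one)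
      then show ?thesis using that by (simp add: add_increasing2)
    next
      case False
      then have "r ^ n \<le> (r\<^sup>2) ^ n"
        by (intro power_mono) (auto simp: power2_eq_square)
      then show ?thesis by simp
    qed
    also have "\<dots> \<le> exp (\<delta> * r\<^sup>2) + fact n / \<delta> ^ n * exp (\<delta> * r\<^sup>2)"
      using e1 e2 by linarith
    finally show ?thesis by (simp add: K_def algebra_simps)
  qed
  ultimately show ?thesis by blast
qed

text \<open>The recursion parallels \<^const>\<open>C_fun\<close>: every derivative of order at most \<open>l\<close>, whatever the order of its
factors, is bounded by \<open>M exp (a \<bar>z\<bar>\<^sup>2)\<close>. This is the shape that induction on \<open>l\<close> can use; up to the
difference between little-o and big-O it is membership in \<^const>\<open>Lam\<close>, with \<open>M\<close> a bound for the norm.\<close>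

fun gauss_bounded :: "real \<Rightarrow> nat \<Rightarrow> real \<Rightarrow> (complex \<Rightarrow> complex) \<Rightarrow> bool" where
  "gauss_bounded a 0 M f \<longleftrightarrow>
     continuous_on UNIV f \<and> (\<forall>z. cmod (f z) \<le> M * exp (a * (cmod z)\<^sup>2))"
| "gauss_bounded a (Suc l) M f \<longleftrightarrow>
     (\<forall>z. f differentiable (at z)) \<and> (\<forall>z. cmod (f z) \<le> M * exp (a * (cmod z)\<^sup>2)) \<and>
     gauss_bounded a l M (partial_x f) \<and> gauss_bounded a l M (partial_y f)"

lemma gauss_boundedD: "gauss_bounded a l M f \<Longrightarrow> cmod (f z) \<le> M * exp (a * (cmod z)\<^sup>2)"
  by (cases l) auto

lemma gauss_bounded_C_fun: "gauss_bounded a l M f \<Longrightarrow> C_fun l f"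
  by (induction l arbitrary: f) auto

lemma gauss_bounded_continuous: "gauss_bounded a l M f \<Longrightarrow> continuous_on UNIV f"
  using gauss_bounded_C_fun C_fun_continuous by blast

lemma gauss_bounded_nonneg: "gauss_bounded a l M f \<Longrightarrow> 0 \<le> M"
  using gauss_boundedD[of a l M f 0] order_trans[OF norm_ge_zero[of "f 0"]] by simp

lemma gauss_bounded_Suc_lower: "gauss_bounded a (Suc l) M f \<Longrightarrow> gauss_bounded a l M f"
proof (induction l arbitrary: f)
  case 0
  then show ?case using gauss_bounded_continuous[OF 0] by simp
next
  case (Suc l)
  then show ?case by (metis gauss_bounded.simps(2))
qed

lemma gauss_bounded_mono:
  assumes "gauss_bounded a l M f" "a \<le> b" "M \<le> N"
  shows "gauss_bounded b l N f"
proof -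
  have "N \<ge> 0" using gauss_bounded_nonneg[OF assms(1)] assms(3) by simp
  then have "M * exp (a * (cmod z)\<^sup>2) \<le> N * exp (b * (cmod z)\<^sup>2)" for z
    using assms by (intro mult_mono) (auto intro!: mult_right_mono)
  then have le: "cmod w \<le> M * exp (a * (cmod z)\<^sup>2) \<Longrightarrow> cmod w \<le> N * exp (b * (cmod z)\<^sup>2)" for z w
    by (meson order_trans)
  show ?thesis
    using assms(1) by (induction l arbitrary: f) (auto intro: le)
qed

lemma gauss_bounded_linear_combination:
  assumes "gauss_bounded a l M f" "gauss_bounded a l N g"
  shows "gauss_bounded a l (cmod c * M + cmod d * N) (\<lambda>z. c * f z + d * g z)"
  using assms
proof (induction l arbitrary: f g)
  case (0 f g)
  have "cmod (c * f z + d * g z) \<le> (cmod c * M + cmod d * N) * exp (a * (cmod z)\<^sup>2)" for z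
  proof -
    have "cmod (c * f z + d * g z) \<le> cmod c * cmod (f z) + cmod d * cmod (g z)"
      by (metis norm_mult norm_triangle_ineq)
    also have "\<dots> \<le> cmod c * (M * exp (a * (cmod z)\<^sup>2)) + cmod d * (N * exp (a * (cmod z)\<^sup>2))"
      using 0 by (intro add_mono mult_left_mono) auto
    finally show ?thesis by (simp add: algebra_simps)
  qed
  then show ?case using 0 by (auto intro!: continuous_intros)
next
  case (Suc l f g)
  then have d: "f differentiable (at z)" "g differentiable (at z)" for z
    by auto
  note L = linear_combination_partials[OF d]
  have "cmod (c * f z + d * g z) \<le> (cmod c * M + cmod d * N) * exp (a * (cmod z)\<^sup>2)" for z
  proof -
    have "cmod (c * f z + d * g z) \<le> cmod c * cmod (f z) + cmod d * cmod (g z)"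
      by (metis norm_mult norm_triangle_ineq)
    also have "\<dots> \<le> cmod c * (M * exp (a * (cmod z)\<^sup>2)) + cmod d * (N * exp (a * (cmod z)\<^sup>2))"
      using Suc.prems by (intro add_mono mult_left_mono) auto
    finally show ?thesis by (simp add: algebra_simps)
  qed
  then show ?case
    using Suc L(1) by (simp add: L(2,3)[abs_def])
qed

lemma gauss_bounded_multi_deriv:
  assumes "gauss_bounded a l M f" "\<alpha> \<in> multi_indices l"
  shows "cmod (multi_deriv \<alpha> f z) \<le> M * exp (a * (cmod z)\<^sup>2)"
proof -
  obtain i j where ij: "\<alpha> = (i, j)" "i + j \<le> l"
    using assms(2) by (cases \<alpha>) (auto simp: multi_indices_def)
  have "cmod (multi_deriv (i, j) f z) \<le> M * exp (a * (cmod z)\<^sup>2)"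
    using assms(1) ij(2)
  proof (induction l arbitrary: i j f)
    case 0
    then show ?case by simp
  next
    case (Suc l)
    show ?case
    proof (cases j)
      case (Suc j')
      then show ?thesis
        using Suc.prems Suc.IH[of "partial_y f" i j'] by (simp add: multi_deriv_Suc_y)
    next
      case 0
      then show ?thesis
        using Suc.prems Suc.IH[of "partial_x f" "i - 1" 0] gauss_boundedD[OF Suc.prems(1)]
        by (cases i) (simp_all add: multi_deriv_x0)
    qed
  qed
  then show ?thesis by (simp add: ij)
qed

text \<open>The bounds on the derivatives in canonical order suffice, because partial derivatives commute.\<close>

lemma gauss_boundedI:
  assumes "C_fun l f"
    and "\<And>i j z. i + j \<le> l \<Longrightarrow> cmod (multi_deriv (i, j) f z) \<le> M * exp (a * (cmod z)\<^sup>2)"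
  shows "gauss_bounded a l M f"
  using assms
proof (induction l arbitrary: f)
  case (0 f)
  then show ?case using "0.prems"(2)[of 0 0] by simp
next
  case (Suc l f)
  have "gauss_bounded a l M (partial_x f)"
  proof (rule Suc.IH)
    fix i j z assume "i + j \<le> l"
    then show "cmod (multi_deriv (i, j) (partial_x f) z) \<le> M * exp (a * (cmod z)\<^sup>2)"
      using Suc.prems(2)[of "Suc i" j z] multi_deriv_partial_x[of i j f]
        C_fun_mono[OF Suc.prems(1), of "Suc (i + j)"] by simp
  qed (use Suc.prems(1) in simp)
  moreover have "gauss_bounded a l M (partial_y f)"
  proof (rule Suc.IH)
    fix i j z assume "i + j \<le> l"
    then show "cmod (multi_deriv (i, j) (partial_y f) z) \<le> M * exp (a * (cmod z)\<^sup>2)"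
      using Suc.prems(2)[of i "Suc j" z] by (simp add: multi_deriv_Suc_y)
  qed (use Suc.prems(1) in simp)
  ultimately show ?case
    using Suc.prems(1) Suc.prems(2)[of 0 0] by simp
qed

text \<open>Outside a large disc the little-o condition bounds the quotient by 1, on the disc continuity does.\<close>

lemma bdd_above_Lam:
  assumes "f \<in> Lam q l" "\<alpha> \<in> multi_indices l"
  shows "bdd_above (range (\<lambda>z. cmod (multi_deriv \<alpha> f z) * exp (- q * (cmod z)\<^sup>2)))"
proof -
  let ?g = "\<lambda>z. cmod (multi_deriv \<alpha> f z) * exp (- q * (cmod z)\<^sup>2)"
  have "multi_deriv \<alpha> f \<in> o[at_infinity](\<lambda>z. complex_of_real (exp (q * (cmod z)\<^sup>2)))"
    using assms by (auto simp: Lam_def)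
  from landau_o.smallD[OF this, of 1]
  obtain R where R: "\<And>z. R \<le> cmod z \<Longrightarrow> cmod (multi_deriv \<alpha> f z) \<le> exp (q * (cmod z)\<^sup>2)"
    by (auto simp: eventually_at_infinity)
  have "continuous_on (cball 0 R) ?g"
    using continuous_multi_deriv[OF _ assms(2), of f] assms(1)
    by (intro continuous_intros) (auto simp: Lam_def intro: continuous_on_subset)
  then have "bounded (?g ` cball 0 R)"
    by (intro compact_imp_bounded compact_continuous_image) auto
  then obtain B where B: "\<And>z. cmod z \<le> R \<Longrightarrow> ?g z \<le> B"
    by (fastforce simp: bounded_iff)
  have "?g z \<le> max B 1" for z
  proof (cases "cmod z \<le> R")
    case False
    then have "?g z \<le> exp (q * (cmod z)\<^sup>2) * exp (- q * (cmod z)\<^sup>2)"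
      by (intro mult_right_mono R) auto
    also have "\<dots> = 1" by (simp add: exp_add[symmetric])
    finally show ?thesis by simp
  qed (use B in \<open>simp add: le_max_iff_disj\<close>)
  then show ?thesis by (rule bdd_aboveI2)
qed

lemma multi_deriv_le_Lam_norm:
  assumes "f \<in> Lam q l" "\<alpha> \<in> multi_indices l"
  shows "cmod (multi_deriv \<alpha> f z) \<le> Lam_norm q l f * exp (q * (cmod z)\<^sup>2)"
proof -
  let ?g = "\<lambda>\<alpha> z. cmod (multi_deriv \<alpha> f z) * exp (- q * (cmod z)\<^sup>2)"
  have "?g \<alpha> z \<le> (SUP z. ?g \<alpha> z)"
    by (rule cSUP_upper[OF _ bdd_above_Lam[OF assms]]) simp
  also have "\<dots> \<le> Lam_norm q l f"
    unfolding Lam_norm_def using assms(2) finite_multi_indices by (intro Max_ge) auto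
  finally show ?thesis
    by (simp add: exp_minus field_simps)
qed

lemma Lam_norm_le:
  assumes "\<And>\<alpha> z. \<alpha> \<in> multi_indices l \<Longrightarrow> cmod (multi_deriv \<alpha> f z) \<le> M * exp (q * (cmod z)\<^sup>2)"
  shows "Lam_norm q l f \<le> M"
  unfolding Lam_norm_def
proof (rule Max.boundedI)
  show "(\<lambda>\<alpha>. SUP z. cmod (multi_deriv \<alpha> f z) * exp (- q * (cmod z)\<^sup>2)) ` multi_indices l \<noteq> {}"
    using multi_indices_0 by auto
next
  fix s assume "s \<in> (\<lambda>\<alpha>. SUP z. cmod (multi_deriv \<alpha> f z) * exp (- q * (cmod z)\<^sup>2)) ` multi_indices l"
  then obtain \<alpha> where \<alpha>: "\<alpha> \<in> multi_indices l"
    and s: "s = (SUP z. cmod (multi_deriv \<alpha> f z) * exp (- q * (cmod z)\<^sup>2))" by auto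
  show "s \<le> M" unfolding s
    by (rule cSUP_least) (use assms[OF \<alpha>] in \<open>auto simp: exp_minus field_simps\<close>)
qed (simp add: finite_multi_indices)

lemma Lam_imp_gauss_bounded:
  assumes "f \<in> Lam q l"
  shows "gauss_bounded q l (Lam_norm q l f) f"
proof (rule gauss_boundedI)
  show "C_fun l f" using assms by (simp add: Lam_def)
qed (rule multi_deriv_le_Lam_norm[OF assms], simp add: multi_indices_def)

text \<open>The strict inequality between the exponents turns a big-O bound into the little-o condition.\<close>

lemma gauss_bounded_imp_Lam:
  assumes f: "gauss_bounded a l M f" and "a < q"
  shows "f \<in> Lam q l" "Lam_norm q l f \<le> M"
proof -
  have M: "M \<ge> 0" using gauss_bounded_nonneg[OF f] .
  have "multi_deriv \<alpha> f \<in> o[at_infinity](\<lambda>z. complex_of_real (exp (q * (cmod z)\<^sup>2)))"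
    if \<alpha>: "\<alpha> \<in> multi_indices l" for \<alpha>
  proof (rule landau_o.smallI)
    fix c :: real assume c: "c > 0"
    define b where "b = max 1 (M / (c * (q - a)))"
    have "cmod (multi_deriv \<alpha> f z) \<le> c * norm (complex_of_real (exp (q * (cmod z)\<^sup>2)))"
      if z: "b \<le> cmod z" for z
    proof -
      have "b \<le> (cmod z)\<^sup>2"
        using z self_le_power[of "cmod z" 2] by (auto simp: b_def)
      then have "M / (c * (q - a)) \<le> (cmod z)\<^sup>2" by (simp add: b_def)
      then have "M \<le> c * ((q - a) * (cmod z)\<^sup>2)"
        using c \<open>a < q\<close> by (simp add: field_simps)
      also have "\<dots> \<le> c * exp ((q - a) * (cmod z)\<^sup>2)"
        using c order_trans[OF _ exp_ge_add_one_self, of _ "(q - a) * (cmod z)\<^sup>2"]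
        by (intro mult_left_mono) auto
      finally have "M * exp (a * (cmod z)\<^sup>2)
          \<le> c * exp ((q - a) * (cmod z)\<^sup>2) * exp (a * (cmod z)\<^sup>2)"
        by (intro mult_right_mono) auto
      also have "\<dots> = c * exp (q * (cmod z)\<^sup>2)"
        by (simp add: exp_add[symmetric] algebra_simps)
      finally show ?thesis
        using gauss_bounded_multi_deriv[OF f \<alpha>, of z] by simp
    qed
    then show "\<forall>\<^sub>F z in at_infinity. cmod (multi_deriv \<alpha> f z)
        \<le> c * norm (complex_of_real (exp (q * (cmod z)\<^sup>2)))"
      by (auto simp: eventually_at_infinity)
  qed
  then show "f \<in> Lam q l"
    using gauss_bounded_C_fun[OF f] by (simp add: Lam_def)
  have "gauss_bounded q l M f" using gauss_bounded_mono[OF f] \<open>a < q\<close> by simp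
  then show "Lam_norm q l f \<le> M"
    using gauss_bounded_multi_deriv by (blast intro: Lam_norm_le)
qed

text \<open>The goal is the case \<open>i = j = 0\<close>; the family of all \<open>x\<^sup>i y\<^sup>j exp (a \<bar>z\<bar>\<^sup>2)\<close> spans a space that is
closed under both partial derivatives, which makes induction on \<open>l\<close> work.\<close>

lemma gauss_monomial_bounded:
  assumes "a < b"
  shows "\<exists>M. gauss_bounded b l M (\<lambda>z. of_real (Re z ^ i * Im z ^ j * exp (a * (cmod z)\<^sup>2)))"
proof -
  define m where "m i j z = complex_of_real (Re z ^ i * Im z ^ j * exp (a * (cmod z)\<^sup>2))" for i j z
  have D: "(m i j has_derivative (\<lambda>h.
      Re h *\<^sub>R (of_nat i * m (i - 1) j z + of_real (2 * a) * m (Suc i) j z) +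
      Im h *\<^sub>R (of_nat j * m i (j - 1) z + of_real (2 * a) * m i (Suc j) z))) (at z)" for i j z
    unfolding m_def[abs_def] cmod_power2
    by (rule has_derivative_eq_rhs, (auto intro!: derivative_eq_intros)[1])
      (auto simp: fun_eq_iff complex_eq_iff algebra_simps power2_eq_square)
  have part: "partial_x (m i j) = (\<lambda>z. of_nat i * m (i - 1) j z + of_real (2 * a) * m (Suc i) j z)"
    "partial_y (m i j) = (\<lambda>z. of_nat j * m i (j - 1) z + of_real (2 * a) * m i (Suc j) z)" for i j
    using partials_eqI[OF D] by (auto simp: fun_eq_iff)
  have bd: "\<exists>M. \<forall>z. cmod (m i j z) \<le> M * exp (b * (cmod z)\<^sup>2)" for i j
  proof -
    obtain K where K: "\<And>r. r \<ge> 0 \<Longrightarrow> r ^ (i + j) \<le> K * exp ((b - a) * r\<^sup>2)"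
      using power_le_exp_square[of "b - a" "i + j"] assms by auto
    have "cmod (m i j z) \<le> K * exp (b * (cmod z)\<^sup>2)" for z
    proof -
      have "cmod (m i j z) = \<bar>Re z\<bar> ^ i * \<bar>Im z\<bar> ^ j * exp (a * (cmod z)\<^sup>2)"
        by (simp add: m_def norm_mult norm_power)
      also have "\<dots> \<le> cmod z ^ i * cmod z ^ j * exp (a * (cmod z)\<^sup>2)"
        by (intro mult_mono mult_right_mono power_mono abs_Re_le_cmod abs_Im_le_cmod) auto
      also have "\<dots> \<le> K * exp ((b - a) * (cmod z)\<^sup>2) * exp (a * (cmod z)\<^sup>2)"
        using K[of "cmod z"] by (intro mult_right_mono) (auto simp: power_add)
      also have "\<dots> = K * exp (b * (cmod z)\<^sup>2)"
        by (simp add: exp_add[symmetric] algebra_simps)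
      finally show ?thesis .
    qed
    then show ?thesis by blast
  qed
  have "\<exists>M. gauss_bounded b l M (m i j)" for l i j
  proof (induction l arbitrary: i j)
    case 0
    have "continuous_on UNIV (m i j)"
      unfolding m_def by (intro continuous_intros)
    then show ?case using bd by simp
  next
    case (Suc l)
    obtain M where M: "\<forall>z. cmod (m i j z) \<le> M * exp (b * (cmod z)\<^sup>2)" using bd by blast
    have comb: "\<exists>M. gauss_bounded b l M (\<lambda>z. c * m i1 j1 z + d * m i2 j2 z)" for c d i1 j1 i2 j2
      using Suc.IH[of i1 j1] Suc.IH[of i2 j2] gauss_bounded_linear_combination by blast
    obtain Mx where Mx: "gauss_bounded b l Mx (partial_x (m i j))" using comb part by metis
    obtain My where My: "gauss_bounded b l My (partial_y (m i j))" using comb part by metis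
    define N where "N = max M (max Mx My)"
    have "cmod (m i j z) \<le> N * exp (b * (cmod z)\<^sup>2)" for z
      using M[rule_format, of z] by (rule order_trans) (auto simp: N_def)
    moreover have "gauss_bounded b l N (partial_x (m i j))"
      using gauss_bounded_mono[OF Mx] by (simp add: N_def)
    moreover have "gauss_bounded b l N (partial_y (m i j))"
      using gauss_bounded_mono[OF My] by (simp add: N_def)
    moreover have "m i j differentiable (at z)" for z using D by (auto simp: differentiable_def)
    ultimately show ?case by auto
  qed
  then show ?thesis by (simp add: m_def[abs_def])
qed

text \<open>These are the test functions that turn membership of \<open>h\<close> in the dual space into the absolute
convergence of \<open>\<integral> \<bar>h\<bar> exp (a \<bar>z\<bar>\<^sup>2)\<close>.\<close>

lemma gauss_in_Lam:
  assumes "a < q"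
  shows "(\<lambda>z. of_real (exp (a * (cmod z)\<^sup>2))) \<in> Lam q l"
proof -
  obtain M where "gauss_bounded ((a + q) / 2) l M (\<lambda>z. of_real (exp (a * (cmod z)\<^sup>2)))"
    using gauss_monomial_bounded[of a "(a + q) / 2" l 0 0] assms by auto
  then show ?thesis
    using assms by (intro gauss_bounded_imp_Lam(1)[of "(a + q) / 2"]) (auto simp: field_simps)
qed

lemma zero_in_Lam: "(\<lambda>z. 0) \<in> Lam q l" "Lam_norm q l (\<lambda>z. 0) \<le> 0"
proof -
  have "(partial_x (\<lambda>z. 0)) = (\<lambda>z. 0)" "(partial_y (\<lambda>z. 0)) = (\<lambda>z. 0)"
    using partials_eqI[OF has_derivative_const[of 0]] by auto
  then have "gauss_bounded (q - 1) l 0 (\<lambda>z. 0)"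
    by (induction l) auto
  from gauss_bounded_imp_Lam[OF this] show "(\<lambda>z. 0) \<in> Lam q l" "Lam_norm q l (\<lambda>z. 0) \<le> 0"
    by auto
qed

lemma Lam_mult:
  assumes "f \<in> Lam q l"
  shows "(\<lambda>z. c * f z) \<in> Lam q l"
proof -
  have C: "C_fun l f" using assms by (simp add: Lam_def)
  have "C_fun l (\<lambda>z. c * f z)"
    using C_fun_linear_combination[OF C C, of c 0] by simp
  then show ?thesis
    using assms zero_in_Lam(1) by (cases "c = 0") (auto simp: Lam_def multi_deriv_mult[OF C])
qed

lemma Lam_norm_mult_le:
  assumes "f \<in> Lam q l"
  shows "Lam_norm q l (\<lambda>z. c * f z) \<le> cmod c * Lam_norm q l f"
proof (rule Lam_norm_le)
  fix \<alpha> z assume \<alpha>: "\<alpha> \<in> multi_indices l"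
  have C: "C_fun l f" using assms by (simp add: Lam_def)
  show "cmod (multi_deriv \<alpha> (\<lambda>z. c * f z) z) \<le> cmod c * Lam_norm q l f * exp (q * (cmod z)\<^sup>2)"
    using mult_left_mono[OF multi_deriv_le_Lam_norm[OF assms \<alpha>, of z], of "cmod c"]
    by (simp add: multi_deriv_mult[OF C \<alpha>] norm_mult mult.assoc)
qed

lemma Lam_norm_nonneg: "f \<in> Lam q l \<Longrightarrow> 0 \<le> Lam_norm q l f"
  using gauss_bounded_nonneg[OF Lam_imp_gauss_bounded] .

lemma bdd_above_Lam_dual:
  assumes T: "T \<in> Lam_dual q l"
  shows "bdd_above ((\<lambda>\<psi>. cmod (T \<psi>)) ` {\<psi>\<in>Lam q l. Lam_norm q l \<psi> \<le> 1})"
proof -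
  obtain C where C: "\<And>\<psi>. \<psi> \<in> Lam q l \<Longrightarrow> cmod (T \<psi>) \<le> C * Lam_norm q l \<psi>"
    using T unfolding Lam_dual_def by blast
  show ?thesis
  proof (rule bdd_aboveI2)
    fix \<psi> assume \<psi>: "\<psi> \<in> {\<psi>\<in>Lam q l. Lam_norm q l \<psi> \<le> 1}"
    then have "cmod (T \<psi>) \<le> \<bar>C\<bar> * Lam_norm q l \<psi>"
      using C[of \<psi>] Lam_norm_nonneg[of \<psi>] by (smt (verit) mem_Collect_eq mult_right_mono)
    also have "\<dots> \<le> \<bar>C\<bar>" using \<psi> by (simp add: mult_left_le)
    finally show "cmod (T \<psi>) \<le> \<bar>C\<bar>" .
  qed
qed

lemma Lam_dual_norm_nonneg:
  assumes "T \<in> Lam_dual q l"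
  shows "0 \<le> Lam_dual_norm q l T"
proof -
  have "(\<lambda>z. 0) \<in> {\<psi>\<in>Lam q l. Lam_norm q l \<psi> \<le> 1}"
    using zero_in_Lam[where q = q and l = l] by simp
  from cSUP_upper[OF this bdd_above_Lam_dual[OF assms]] show ?thesis
    unfolding Lam_dual_norm_def by (rule order_trans[OF norm_ge_zero])
qed

text \<open>The usual scaling argument; elements of norm \<open>0\<close> cannot be normalized, but there the a priori bound in
the definition of the dual already gives \<open>T f = 0\<close>.\<close>

lemma Lam_dual_bound:
  assumes T: "T \<in> Lam_dual q l" and f: "f \<in> Lam q l"
  shows "cmod (T f) \<le> Lam_dual_norm q l T * Lam_norm q l f"
proof -
  obtain C where C: "\<And>\<psi>. \<psi> \<in> Lam q l \<Longrightarrow> cmod (T \<psi>) \<le> C * Lam_norm q l \<psi>"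
    using T unfolding Lam_dual_def by blast
  have Tm: "T (\<lambda>z. c * f z) = c * T f" for c
    using T f by (auto simp: Lam_dual_def)
  define N where "N = Lam_norm q l f"
  show ?thesis
  proof (cases "N = 0")
    case True
    then show ?thesis using C[OF f] by (simp add: N_def)
  next
    case False
    then have N: "N > 0" using Lam_norm_nonneg[OF f] by (simp add: N_def)
    have "Lam_norm q l (\<lambda>z. of_real (1 / N) * f z) \<le> 1"
      using Lam_norm_mult_le[OF f, of "of_real (1 / N)"] N by (simp add: N_def norm_divide)
    then have "(\<lambda>z. of_real (1 / N) * f z) \<in> {\<psi>\<in>Lam q l. Lam_norm q l \<psi> \<le> 1}"
      using Lam_mult[OF f] by blast
    from cSUP_upper[OF this bdd_above_Lam_dual[OF T]]
    have "cmod (T (\<lambda>z. of_real (1 / N) * f z)) \<le> Lam_dual_norm q l T"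
      by (simp add: Lam_dual_norm_def)
    then have "cmod (T f) / N \<le> Lam_dual_norm q l T"
      using N unfolding Tm by (simp add: norm_mult norm_divide)
    then show ?thesis using N by (simp add: N_def field_simps)
  qed
qed

section \<open>Integration on the plane\<close>

text \<open>Differentiation under the integral sign: by the mean value inequality the difference quotients are
dominated by \<open>2 B\<close>, so dominated convergence applies along every sequence of increments.\<close>

lemma has_derivative_lebesgue_integral:
  fixes f :: "'a::real_normed_vector \<Rightarrow> 'b \<Rightarrow> 'c::{banach, second_countable_topology}"
  assumes "r > 0"
    and int: "\<And>x. x \<in> ball x0 r \<Longrightarrow> integrable M (f x)"
    and der: "\<And>x t. x \<in> ball x0 r \<Longrightarrow> ((\<lambda>x. f x t) has_derivative f' x t) (at x)"
    and bd: "\<And>x t h. x \<in> ball x0 r \<Longrightarrow> norm (f' x t h) \<le> B t * norm h"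
    and intB: "integrable M B"
    and int': "\<And>h. integrable M (\<lambda>t. f' x0 t h)"
  shows "((\<lambda>x. LINT t|M. f x t) has_derivative (\<lambda>h. LINT t|M. f' x0 t h)) (at x0)"
proof -
  have x0: "x0 \<in> ball x0 r" using \<open>r > 0\<close> by simp
  have bl: "bounded_linear (f' x t)" if "x \<in> ball x0 r" for x t
    using der[OF that] by (rule has_derivative_bounded_linear)
  note add = linear_add[OF bounded_linear.linear[OF bl[OF x0]]]
  note scale = linear_scale[OF bounded_linear.linear[OF bl[OF x0]]]
  have "bounded_linear (\<lambda>h. LINT t|M. f' x0 t h)"
  proof (rule bounded_linear_intro[where K = "LINT t|M. B t"])
    fix h
    have "norm (LINT t|M. f' x0 t h) \<le> (LINT t|M. norm (f' x0 t h))" by simp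
    also have "\<dots> \<le> (LINT t|M. B t * norm h)"
      using bd[OF x0] intB int' by (intro integral_mono) auto
    finally show "norm (LINT t|M. f' x0 t h) \<le> norm h * (LINT t|M. B t)" by (simp add: mult.commute)
  qed (simp_all add: add scale int')
  moreover have "(\<lambda>h. norm ((LINT t|M. f (x0 + h) t) - (LINT t|M. f x0 t) - (LINT t|M. f' x0 t h)) / norm h)
      \<midarrow>0\<rightarrow> 0"
    unfolding tendsto_at_iff_sequentially
  proof (intro allI impI)
    fix X :: "nat \<Rightarrow> 'a" assume X: "\<forall>i. X i \<in> UNIV - {0}" "X \<longlonglongrightarrow> 0"
    define s where "s i t = (if norm (X i) < r
        then (f (x0 + X i) t - f x0 t - f' x0 t (X i)) /\<^sub>R norm (X i) else 0)" for i t
    have ev: "\<forall>\<^sub>F i in sequentially. norm (X i) < r"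
      using order_tendstoD(2)[OF tendsto_norm_zero[OF X(2)] \<open>r > 0\<close>] .
    have ints: "integrable M (s i)" for i
    proof (cases "norm (X i) < r")
      case True
      then have "integrable M (f (x0 + X i))" by (intro int) (simp add: dist_norm)
      then show ?thesis using True int[OF x0] int' by (simp add: s_def[abs_def])
    qed (simp add: s_def[abs_def])
    have lims: "(\<lambda>i. s i t) \<longlonglongrightarrow> 0" for t
    proof -
      have "(\<lambda>h. norm (f (x0 + h) t - f x0 t - f' x0 t h) / norm h) \<midarrow>0\<rightarrow> 0"
        using der[OF x0] by (simp add: has_derivative_at)
      then have "(\<lambda>i. norm (f (x0 + X i) t - f x0 t - f' x0 t (X i)) / norm (X i)) \<longlonglongrightarrow> 0"
        using X by (auto simp: tendsto_at_iff_sequentially o_def)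
      then have "(\<lambda>i. norm (s i t)) \<longlonglongrightarrow> 0"
        by (rule Lim_transform_eventually)
          (use ev in \<open>auto elim!: eventually_mono simp: s_def divide_inverse mult.commute\<close>)
      then show ?thesis by (rule tendsto_norm_zero_cancel)
    qed
    have B0: "0 \<le> B t" for t
    proof -
      have "0 \<le> B t * norm (X 0)" using bd[OF x0, of t "X 0"] norm_ge_zero order_trans by blast
      then show ?thesis using X(1) by (simp add: zero_le_mult_iff)
    qed
    have bds: "norm (s i t) \<le> 2 * B t" for i t
    proof (cases "norm (X i) < r")
      case True
      have "norm (f (x0 + X i) t - f x0 t) \<le> B t * norm ((x0 + X i) - x0)"
      proof (rule differentiable_bound[OF convex_ball])
        show "((\<lambda>x. f x t) has_derivative f' x t) (at x within ball x0 r)" if "x \<in> ball x0 r" for x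
          using der[OF that] by (rule has_derivative_at_withinI)
        show "onorm (f' x t) \<le> B t" if "x \<in> ball x0 r" for x
          using bd[OF that] B0 by (rule onorm_bound[rotated])
      qed (use True \<open>r > 0\<close> in \<open>auto simp: dist_norm\<close>)
      moreover have "norm (f' x0 t (X i)) \<le> B t * norm (X i)" using bd[OF x0] .
      ultimately have "norm (f (x0 + X i) t - f x0 t - f' x0 t (X i)) \<le> 2 * B t * norm (X i)"
        using norm_triangle_ineq4[of "f (x0 + X i) t - f x0 t" "f' x0 t (X i)"] by simp
      moreover have "norm (s i t) = norm (f (x0 + X i) t - f x0 t - f' x0 t (X i)) / norm (X i)"
        using True by (simp add: s_def divide_inverse mult.commute)
      ultimately show ?thesis using X(1) by (simp add: pos_divide_le_eq)
    qed (simp add: s_def B0)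
    have "(\<lambda>i. LINT t|M. s i t) \<longlonglongrightarrow> (LINT t|M. 0)"
      by (rule integral_dominated_convergence[where w = "\<lambda>t. 2 * B t"])
        (use lims bds intB ints in auto)
    then have "(\<lambda>i. norm (LINT t|M. s i t)) \<longlonglongrightarrow> 0"
      by (simp add: tendsto_norm_zero)
    moreover have "\<forall>\<^sub>F i in sequentially. norm (LINT t|M. s i t) =
        norm ((LINT t|M. f (x0 + X i) t) - (LINT t|M. f x0 t) - (LINT t|M. f' x0 t (X i))) / norm (X i)"
      using ev
    proof eventually_elim
      case (elim i)
      then have "integrable M (f (x0 + X i))" by (intro int) (simp add: dist_norm)
      then show ?case
        using elim int[OF x0] int' by (simp add: s_def divide_inverse mult.commute)
    qed
    ultimately show "((\<lambda>h. norm ((LINT t|M. f (x0 + h) t) - (LINT t|M. f x0 t)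
        - (LINT t|M. f' x0 t h)) / norm h) \<circ> X) \<longlonglongrightarrow> 0"
      unfolding o_def by (rule Lim_transform_eventually)
  qed
  ultimately show ?thesis by (simp add: has_derivative_at)
qed

lemma lborel_complex_affine:
  fixes c :: real and t :: complex and f :: "complex \<Rightarrow> complex"
  assumes "c \<noteq> 0"
  shows lborel_integrable_complex_affine: "integrable lborel f \<Longrightarrow> integrable lborel (\<lambda>x. f (t + of_real c * x))"
    and lborel_integral_complex_affine:
      "f \<in> borel_measurable borel \<Longrightarrow>
        (LINT x|lborel. f x) = of_real (c\<^sup>2) * (LINT x|lborel. f (t + of_real c * x))"
proof -
  let ?T = "\<lambda>x::complex. t + c *\<^sub>R x"
  have eq: "lborel = density (distr lborel borel ?T) (\<lambda>_. ennreal (\<bar>c\<bar> ^ DIM(complex)))"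
    using lborel_affine[OF assms, of t] .
  show "integrable lborel (\<lambda>x. f (t + of_real c * x))" if f: "integrable lborel f"
  proof -
    have [measurable]: "f \<in> borel_measurable borel" using f by (simp add: borel_measurable_integrable)
    have "integrable (density (distr lborel borel ?T) (\<lambda>_. ennreal (\<bar>c\<bar> ^ DIM(complex)))) f"
      using f eq by simp
    then have "integrable lborel (\<lambda>x. c\<^sup>2 *\<^sub>R f (?T x))"
      by (simp add: integrable_density integrable_distr_eq)
    from integrable_scaleR_right[OF this, of "1 / c\<^sup>2"]
    show ?thesis using assms by (simp add: scaleR_conv_of_real)
  qed
  show "(LINT x|lborel. f x) = of_real (c\<^sup>2) * (LINT x|lborel. f (t + of_real c * x))"
    if [measurable]: "f \<in> borel_measurable borel"
  proof -
    have "(LINT x|lborel. f x) = (LINT x|density (distr lborel borel ?T) (\<lambda>_. ennreal (\<bar>c\<bar> ^ DIM(complex))). f x)"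
      using eq by simp
    also have "\<dots> = (LINT x|lborel. c\<^sup>2 *\<^sub>R f (?T x))"
      by (simp add: integral_density integral_distr)
    also have "\<dots> = c\<^sup>2 *\<^sub>R (LINT x|lborel. f (?T x))" by (rule integral_scaleR_right)
    finally show ?thesis by (simp add: scaleR_conv_of_real)
  qed
qed

lemma lborel_complex:
  "distr (lborel \<Otimes>\<^sub>M lborel) borel (\<lambda>(x, y). of_real x + \<i> * of_real y) = (lborel :: complex measure)"
proof (rule lborel_eqI[symmetric])
  fix l u :: complex assume le: "\<And>b. b \<in> Basis \<Longrightarrow> l \<bullet> b \<le> u \<bullet> b"
  then have le': "Re l \<le> Re u" "Im l \<le> Im u"
    using le[of 1] le[of \<i>] by (simp_all add: Basis_complex_def)
  have [measurable]: "(\<lambda>(x, y). complex_of_real x + \<i> * of_real y) \<in> borel_measurable (lborel \<Otimes>\<^sub>M lborel)"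
    by measurable
  have "(\<lambda>(x, y). complex_of_real x + \<i> * of_real y) -` box l u \<inter> space (lborel \<Otimes>\<^sub>M lborel)
      = {Re l<..<Re u} \<times> {Im l<..<Im u}"
    by (auto simp: box_def Basis_complex_def space_pair_measure)
  then show "emeasure (distr (lborel \<Otimes>\<^sub>M lborel) borel (\<lambda>(x, y). complex_of_real x + \<i> * of_real y)) (box l u)
      = ennreal (\<Prod>b\<in>Basis. (u - l) \<bullet> b)"
    using le' by (simp add: emeasure_distr lborel.emeasure_pair_measure_Times Basis_complex_def ennreal_mult)
qed simp

text \<open>The primitive on the positive half-line is \<open>2 arctan (sqrt x)\<close>.\<close>

lemma integrable_sqrt_weight: "integrable lborel (\<lambda>x::real. 1 / (sqrt \<bar>x\<bar> * (1 + \<bar>x\<bar>)))"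
proof -
  define g where "g x = 1 / (sqrt \<bar>x\<bar> * (1 + \<bar>x\<bar>))" for x :: real
  have gm [measurable]: "g \<in> borel_measurable borel" unfolding g_def by measurable
  have "set_integrable lborel (einterval 0 \<infinity>) g"
  proof (rule interval_integral_FTC_nonneg)
    show "((\<lambda>x. 2 * arctan (sqrt x)) has_real_derivative g x) (at x)"
      if "0 < ereal x" "ereal x < \<infinity>" for x
    proof -
      have "x > 0" using that by simp
      then show ?thesis
        by (auto intro!: derivative_eq_intros simp: g_def divide_simps)
    qed
    show "isCont g x" if "0 < ereal x" "ereal x < \<infinity>" for x
      unfolding g_def using that by (intro continuous_intros) auto
    show "AE x in lborel. 0 < ereal x \<longrightarrow> ereal x < \<infinity> \<longrightarrow> 0 \<le> g x" by (simp add: g_def)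
    have "((\<lambda>x. 2 * arctan (sqrt x)) \<longlongrightarrow> 2 * arctan (sqrt 0)) (at_right 0)"
      by (intro tendsto_intros)
    then show "(((\<lambda>x. 2 * arctan (sqrt x)) \<circ> real_of_ereal) \<longlongrightarrow> 0) (at_right 0)"
      by (simp add: zero_ereal_def ereal_tendsto_simps)
    have "filterlim (sqrt :: real \<Rightarrow> real) at_top at_top" by (rule sqrt_at_top)
    then have "((\<lambda>x. 2 * arctan (sqrt x)) \<longlongrightarrow> 2 * (pi / 2)) at_top"
      by (intro tendsto_intros filterlim_compose[OF tendsto_arctan_at_top])
    then show "(((\<lambda>x. 2 * arctan (sqrt x)) \<circ> real_of_ereal) \<longlongrightarrow> pi) (at_left \<infinity>)"
      by (simp add: ereal_tendsto_simps)
  qed simp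
  then have pos: "integrable lborel (\<lambda>x. indicator {0<..} x * g x)"
    by (simp add: set_integrable_def einterval_eq zero_ereal_def)
  have neg: "integrable lborel (\<lambda>x. indicator {0<..} (0 + (- 1) * x) * g (0 + (- 1) * x))"
    using lborel_integrable_real_affine[OF pos, of "-1" 0] by simp
  have "g = (\<lambda>x. indicator {0<..} x * g x + indicator {0<..} (0 + (- 1) * x) * g (0 + (- 1) * x))"
    by (auto simp: g_def fun_eq_iff indicator_def)
  then have "integrable lborel g"
    using Bochner_Integration.integrable_add[OF pos neg] by simp
  then show ?thesis by (simp add: g_def[abs_def])
qed

text \<open>A radial weight with the singularity of the Cauchy kernel at \<open>0\<close> and just enough decay to be integrable
over the plane. The singular integrals below converge by comparison with it.\<close>

definition rho :: "complex \<Rightarrow> real" where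
  "rho s = 1 / (cmod s * (1 + (cmod s)\<^sup>2))"

lemma rho_nonneg: "rho s \<ge> 0" by (simp add: rho_def)

lemma borel_measurable_rho [measurable]: "rho \<in> borel_measurable borel"
  unfolding rho_def[abs_def] by measurable

text \<open>In coordinates the weight is at most \<open>3 g(x) g(y)\<close> with \<open>g(x) = 1 / (sqrt \<bar>x\<bar> (1 + \<bar>x\<bar>))\<close>: the geometric
mean of \<open>\<bar>x\<bar>\<close> and \<open>\<bar>y\<bar>\<close> is at most \<open>\<bar>s\<bar>\<close>, and \<open>(1 + \<bar>x\<bar>) (1 + \<bar>y\<bar>) \<le> 3 (1 + \<bar>s\<bar>\<^sup>2)\<close>. Tonelli reduces the
claim to the line.\<close>

lemma integrable_rho: "integrable lborel rho"
proof (rule integrableI_nonneg)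
  define g where "g x = 1 / (sqrt \<bar>x\<bar> * (1 + \<bar>x\<bar>))" for x :: real
  have gm [measurable]: "g \<in> borel_measurable borel" unfolding g_def by measurable
  have g0: "g x \<ge> 0" for x by (simp add: g_def)
  have le: "rho (of_real x + \<i> * of_real y) \<le> 3 * g x * g y" if "x \<noteq> 0" "y \<noteq> 0" for x y
  proof -
    define r where "r = cmod (of_real x + \<i> * of_real y)"
    have r2: "r\<^sup>2 = \<bar>x\<bar>\<^sup>2 + \<bar>y\<bar>\<^sup>2" by (simp add: r_def cmod_power2)
    have r0: "r \<ge> 0" by (simp add: r_def)
    have xy: "2 * (\<bar>x\<bar> * \<bar>y\<bar>) \<le> r\<^sup>2"
      using zero_le_power2[of "\<bar>x\<bar> - \<bar>y\<bar>"] by (simp add: r2 power2_diff)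
    have pos: "0 < \<bar>x\<bar> * \<bar>y\<bar>" using that by simp
    have "sqrt (\<bar>x\<bar> * \<bar>y\<bar>) \<le> r"
      using xy pos r0 by (intro real_le_lsqrt) auto
    then have 1: "sqrt \<bar>x\<bar> * sqrt \<bar>y\<bar> \<le> r" by (simp add: real_sqrt_mult)
    have "(1 + a) * (1 + b) \<le> 3 * (1 + R)" if "2 * (a * b) \<le> R" "R = a\<^sup>2 + b\<^sup>2" for a b R :: real
    proof -
      have "(1 + a) * (1 + b) = 1 + a + b + a * b" by (simp add: algebra_simps)
      moreover have "2 * a \<le> 1 + a\<^sup>2" "2 * b \<le> 1 + b\<^sup>2"
        using zero_le_power2[of "a - 1"] zero_le_power2[of "b - 1"] by (simp_all add: power2_diff)
      moreover have "1 + a + b + P \<le> 3 * (1 + R)"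
        if "2 * a \<le> 1 + A" "2 * b \<le> 1 + B" "2 * P \<le> R" "R = A + B" "0 \<le> A" "0 \<le> B" for P A B :: real
        using that by argo
      ultimately show ?thesis
        using that by (metis zero_le_power2)
    qed
    from this[OF xy r2] have 2: "(1 + \<bar>x\<bar>) * (1 + \<bar>y\<bar>) \<le> 3 * (1 + r\<^sup>2)" .
    have "(sqrt \<bar>x\<bar> * sqrt \<bar>y\<bar>) * ((1 + \<bar>x\<bar>) * (1 + \<bar>y\<bar>)) \<le> r * (3 * (1 + r\<^sup>2))"
      by (rule mult_mono[OF 1 2 r0]) auto
    moreover have "0 < (sqrt \<bar>x\<bar> * sqrt \<bar>y\<bar>) * ((1 + \<bar>x\<bar>) * (1 + \<bar>y\<bar>))"
      using that by (intro mult_pos_pos) auto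
    ultimately have "1 / (r * (3 * (1 + r\<^sup>2))) \<le> 1 / ((sqrt \<bar>x\<bar> * sqrt \<bar>y\<bar>) * ((1 + \<bar>x\<bar>) * (1 + \<bar>y\<bar>)))"
      by (simp only: inverse_eq_divide[symmetric] le_imp_inverse_le)
    then have "3 * (1 / (r * (3 * (1 + r\<^sup>2)))) \<le> 3 * (1 / ((sqrt \<bar>x\<bar> * sqrt \<bar>y\<bar>) * ((1 + \<bar>x\<bar>) * (1 + \<bar>y\<bar>))))"
      by (intro mult_left_mono) auto
    moreover have "3 * (1 / (r * (3 * A))) = 1 / (r * A)" for A :: real by simp
    ultimately show ?thesis
      unfolding rho_def g_def r_def[symmetric] by (simp add: mult_ac del: distrib_left_numeral)
  qed
  have gfin: "(\<integral>\<^sup>+x. ennreal (g x) \<partial>lborel) < \<infinity>"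
    using integrable_sqrt_weight g0 by (simp add: g_def[abs_def] integrable_iff_bounded)
  have "(\<integral>\<^sup>+s. ennreal (rho s) \<partial>lborel) =
      (\<integral>\<^sup>+s. ennreal (rho s) \<partial>distr (lborel \<Otimes>\<^sub>M lborel) borel (\<lambda>(x, y). of_real x + \<i> * of_real y))"
    by (simp add: lborel_complex)
  also have "\<dots> = (\<integral>\<^sup>+p. ennreal (rho (of_real (fst p) + \<i> * of_real (snd p))) \<partial>(lborel \<Otimes>\<^sub>M lborel))"
    by (subst nn_integral_distr) (auto simp: split_beta)
  also have "\<dots> = (\<integral>\<^sup>+x. \<integral>\<^sup>+y. ennreal (rho (of_real x + \<i> * of_real y)) \<partial>lborel \<partial>lborel)"
    by (subst lborel.nn_integral_fst[symmetric]) auto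
  also have "\<dots> \<le> (\<integral>\<^sup>+x. \<integral>\<^sup>+y. ennreal 3 * ennreal (g x) * ennreal (g y) \<partial>lborel \<partial>lborel)"
  proof (rule nn_integral_mono_AE)
    show "AE x in lborel. (\<integral>\<^sup>+y. ennreal (rho (of_real x + \<i> * of_real y)) \<partial>lborel)
        \<le> (\<integral>\<^sup>+y. ennreal 3 * ennreal (g x) * ennreal (g y) \<partial>lborel)"
      using AE_lborel_singleton[of 0]
    proof eventually_elim
      case (elim x)
      show ?case
      proof (rule nn_integral_mono_AE)
        show "AE y in lborel. ennreal (rho (of_real x + \<i> * of_real y))
            \<le> ennreal 3 * ennreal (g x) * ennreal (g y)"
          using AE_lborel_singleton[of 0]
        proof eventually_elim
          case (elim y)
          then show ?case
            using le[of x y] \<open>x \<noteq> 0\<close> g0 by (simp add: ennreal_mult[symmetric] ennreal_leI del: ennreal_numeral)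
        qed
      qed
    qed
  qed
  also have "\<dots> = ennreal 3 * (\<integral>\<^sup>+x. ennreal (g x) \<partial>lborel) * (\<integral>\<^sup>+y. ennreal (g y) \<partial>lborel)"
    by (simp add: nn_integral_cmult nn_integral_multc del: ennreal_numeral)
  also have "\<dots> < \<infinity>"
    using gfin by (simp add: ennreal_mult_less_top)
  finally show "(\<integral>\<^sup>+s. ennreal (rho s) \<partial>lborel) < \<infinity>" .
qed (auto simp: rho_nonneg)

lemma integrable_le_rho:
  fixes f :: "complex \<Rightarrow> 'a::{banach, second_countable_topology}"
  assumes "f \<in> borel_measurable borel" "\<And>s. s \<noteq> 0 \<Longrightarrow> norm (f s) \<le> C * rho s"
  shows "integrable lborel f"
proof (rule Bochner_Integration.integrable_bound)
  show "integrable lborel (\<lambda>s. C * rho s)" using integrable_rho by simp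
  show "AE s in lborel. norm (f s) \<le> norm (C * rho s)"
    using AE_lborel_singleton[of 0]
    by eventually_elim (use assms(2) in \<open>auto intro: order_trans[OF _ abs_ge_self]\<close>)
qed (use assms(1) in simp)

definition gauss_kernel :: "real \<Rightarrow> nat \<Rightarrow> complex \<Rightarrow> real" where
  "gauss_kernel a k s = cmod s ^ k * exp (- a * (cmod s)\<^sup>2) / cmod s"

lemma gauss_kernel_nonneg: "0 \<le> gauss_kernel a k s"
  by (simp add: gauss_kernel_def)

lemma gauss_kernel_le_rho:
  assumes "a > 0"
  shows "\<exists>C\<ge>0. \<forall>s. gauss_kernel a k s \<le> C * rho s"
proof -
  obtain K1 where K1: "K1 \<ge> 0" "\<And>r. r \<ge> 0 \<Longrightarrow> r ^ k \<le> K1 * exp (a * r\<^sup>2)"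
    using power_le_exp_square[OF assms, of k] by auto
  obtain K2 where K2: "K2 \<ge> 0" "\<And>r. r \<ge> 0 \<Longrightarrow> r ^ (k + 2) \<le> K2 * exp (a * r\<^sup>2)"
    using power_le_exp_square[OF assms, of "k + 2"] by auto
  have "gauss_kernel a k s \<le> (K1 + K2) * rho s" for s
  proof -
    have "cmod s ^ k * (1 + (cmod s)\<^sup>2) \<le> (K1 + K2) * exp (a * (cmod s)\<^sup>2)"
      using K1(2)[of "cmod s"] K2(2)[of "cmod s"] by (simp add: power_add algebra_simps power2_eq_square)
    then have "cmod s ^ k * exp (- a * (cmod s)\<^sup>2) \<le> (K1 + K2) / (1 + (cmod s)\<^sup>2)"
      using add_pos_nonneg[OF zero_less_one zero_le_power2[of "cmod s"]] by (simp add: exp_minus field_simps)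
    then have "cmod s ^ k * exp (- a * (cmod s)\<^sup>2) / cmod s \<le> (K1 + K2) / (1 + (cmod s)\<^sup>2) / cmod s"
      by (intro divide_right_mono) auto
    then show ?thesis by (simp add: gauss_kernel_def rho_def mult.commute)
  qed
  then show ?thesis using K1(1) K2(1) by (intro exI[of _ "K1 + K2"]) auto
qed

lemma borel_measurable_gauss_kernel [measurable]: "gauss_kernel a k \<in> borel_measurable borel"
  unfolding gauss_kernel_def[abs_def] by measurable

lemma integrable_gauss_kernel:
  assumes "a > 0"
  shows "integrable lborel (gauss_kernel a k)"
proof -
  obtain C where "\<forall>s. gauss_kernel a k s \<le> C * rho s"
    using gauss_kernel_le_rho[OF assms] by blast
  then show ?thesis
    by (intro integrable_le_rho[where C = C]) (auto simp: gauss_kernel_nonneg)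
qed

text \<open>Fubini for a bilinear form given by a kernel. The hypotheses ask for bounds after integration in \<open>w\<close>
only, because nothing but a weighted \<open>L\<^sup>1\<close> norm of \<open>h\<close> is known.\<close>

lemma kernel_transpose:
  fixes h g :: "complex \<Rightarrow> complex" and K :: "complex \<Rightarrow> complex \<Rightarrow> complex"
  assumes [measurable]: "h \<in> borel_measurable borel" "g \<in> borel_measurable borel"
      "(\<lambda>(z, w). K z w) \<in> borel_measurable (borel \<Otimes>\<^sub>M borel)"
    and int: "\<And>z. integrable lborel (\<lambda>w. K z w * g w)"
    and bd: "\<And>z. (LINT w|lborel. cmod (K z w * g w)) \<le> B z"
    and intB: "integrable lborel (\<lambda>z. cmod (h z) * B z)"
  shows "integrable lborel (\<lambda>w. (LINT z|lborel. h z * K z w) * g w)"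
    and "(LINT w|lborel. (LINT z|lborel. h z * K z w) * g w) =
         (LINT z|lborel. h z * (LINT w|lborel. K z w * g w))"
proof -
  have I: "integrable (lborel \<Otimes>\<^sub>M lborel) (\<lambda>(z, w). h z * K z w * g w)"
  proof (rule lborel_pair.Fubini_integrable)
    show "(\<lambda>(z, w). h z * K z w * g w) \<in> borel_measurable (lborel \<Otimes>\<^sub>M lborel)"
      by measurable
    show "AE z in lborel. integrable lborel (\<lambda>w. case (z, w) of (z, w) \<Rightarrow> h z * K z w * g w)"
      using int by (auto intro!: AE_I2 integrable_mult_right simp: mult.assoc)
    show "integrable lborel (\<lambda>z. LINT w|lborel. norm (case (z, w) of (z, w) \<Rightarrow> h z * K z w * g w))"
    proof (rule Bochner_Integration.integrable_bound[OF intB])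
      show "(\<lambda>z. LINT w|lborel. norm (case (z, w) of (z, w) \<Rightarrow> h z * K z w * g w)) \<in> borel_measurable lborel"
        by measurable
      have "norm (LINT w|lborel. norm (h z * K z w * g w)) \<le> norm (cmod (h z) * B z)" for z
      proof -
        have "(LINT w|lborel. norm (h z * K z w * g w)) = cmod (h z) * (LINT w|lborel. cmod (K z w * g w))"
          by (simp add: norm_mult mult.assoc)
        also have "\<dots> \<le> cmod (h z) * B z" using bd by (intro mult_left_mono) auto
        finally have "(LINT w|lborel. norm (h z * K z w * g w)) \<le> \<bar>cmod (h z) * B z\<bar>" by linarith
        moreover have "0 \<le> (LINT w|lborel. norm (h z * K z w * g w))" by (rule integral_nonneg_AE) auto
        ultimately show ?thesis by simp
      qed
      then show "AE z in lborel. norm (LINT w|lborel. norm (case (z, w) of (z, w) \<Rightarrow> h z * K z w * g w))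
          \<le> norm (cmod (h z) * B z)" by simp
    qed
  qed
  show "integrable lborel (\<lambda>w. (LINT z|lborel. h z * K z w) * g w)"
    using lborel_pair.integrable_snd[OF I] by simp
  show "(LINT w|lborel. (LINT z|lborel. h z * K z w) * g w) =
         (LINT z|lborel. h z * (LINT w|lborel. K z w * g w))"
  proof -
    have L: "(LINT z|lborel. h z * K z w * g w) = (LINT z|lborel. h z * K z w) * g w" for w
      by simp
    have R: "(LINT w|lborel. h z * K z w * g w) = h z * (LINT w|lborel. K z w * g w)" for z
      by (simp add: mult.assoc)
    show ?thesis using lborel_pair.Fubini_integral[OF I] by (simp only: L R)
  qed
qed

section \<open>A solution operator that preserves Gaussian growth\<close>

text \<open>For \<open>k = 0\<close> and \<open>s = z - w\<close> this is the Cauchy kernel \<open>1 / (z - w)\<close> times \<open>exp (2 a cnj w (z - w))\<close>. The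
exponential is entire in \<open>z\<close> and equals 1 at \<open>z = w\<close>, so it does not change the \<open>\<partial>\<close>-bar derivative
in \<open>z\<close>. Differentiating it in \<open>z\<close> brings down factors \<open>s\<close>, which the power \<open>s\<^sup>k\<close> records.\<close>

definition twisted_kernel :: "real \<Rightarrow> nat \<Rightarrow> complex \<Rightarrow> complex \<Rightarrow> complex" where
  "twisted_kernel a k z s = s ^ k * exp (of_real (2 * a) * cnj (z - s) * s) / s"

text \<open>For \<open>k = 0\<close> this is \<open>\<pi>\<close> times a solution \<open>v\<close> of \<open>\<partial>\<close>-bar \<open>v = f\<close>. It is written as a convolution integral
so that derivatives in \<open>z\<close> fall on \<open>f\<close> and on the exponential, but not on the singular factor \<open>1 / s\<close>.\<close>

definition solve :: "real \<Rightarrow> nat \<Rightarrow> (complex \<Rightarrow> complex) \<Rightarrow> complex \<Rightarrow> complex" where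
  "solve a k f z = (LINT s|lborel. f (z - s) * twisted_kernel a k z s)"

text \<open>The identity that drives the whole estimate: \<open>2 Re (cnj (z - s) s) = \<bar>z\<bar>\<^sup>2 - \<bar>z - s\<bar>\<^sup>2 - \<bar>s\<bar>\<^sup>2\<close>. The twist
converts the weight \<open>exp (a \<bar>z - s\<bar>\<^sup>2)\<close> of \<open>f (z - s)\<close> into \<open>exp (a \<bar>z\<bar>\<^sup>2)\<close> and leaves the Gaussian
\<open>exp (- a \<bar>s\<bar>\<^sup>2)\<close> to make the integral in \<open>s\<close> converge.\<close>

lemma norm_twist:
  "cmod (exp (of_real (2 * a) * cnj (z - s) * s))
    = exp (a * ((cmod z)\<^sup>2 - (cmod (z - s))\<^sup>2 - (cmod s)\<^sup>2))"
  unfolding norm_exp_eq_Re cmod_power2 by (simp add: algebra_simps power2_eq_square)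

lemma norm_solve_integrand:
  assumes "\<And>w. cmod (f w) \<le> M * exp (a * (cmod w)\<^sup>2)"
  shows "cmod (f (z - s) * twisted_kernel a k z s) \<le> M * exp (a * (cmod z)\<^sup>2) * gauss_kernel a k s"
proof -
  have "cmod (f (z - s) * twisted_kernel a k z s) =
      cmod (f (z - s)) * (cmod s ^ k * exp (a * ((cmod z)\<^sup>2 - (cmod (z - s))\<^sup>2 - (cmod s)\<^sup>2)) / cmod s)"
    unfolding twisted_kernel_def norm_mult norm_divide norm_power norm_twist ..
  also have "\<dots> \<le> M * exp (a * (cmod (z - s))\<^sup>2) *
      (cmod s ^ k * exp (a * ((cmod z)\<^sup>2 - (cmod (z - s))\<^sup>2 - (cmod s)\<^sup>2)) / cmod s)"
    by (intro mult_right_mono assms) auto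
  also have "\<dots> = M * (exp (a * (cmod (z - s))\<^sup>2) *
      exp (a * ((cmod z)\<^sup>2 - (cmod (z - s))\<^sup>2 - (cmod s)\<^sup>2))) * cmod s ^ k / cmod s"
    by (simp add: mult_ac)
  also have "exp (a * (cmod (z - s))\<^sup>2) * exp (a * ((cmod z)\<^sup>2 - (cmod (z - s))\<^sup>2 - (cmod s)\<^sup>2))
      = exp (a * (cmod z)\<^sup>2) * exp (- a * (cmod s)\<^sup>2)"
    unfolding exp_add[symmetric] by (rule arg_cong[where f = exp]) (simp add: algebra_simps)
  finally show ?thesis by (simp add: gauss_kernel_def mult_ac)
qed

lemma measurable_solve_integrand:
  assumes "continuous_on UNIV f"
  shows "(\<lambda>s. f (z - s) * twisted_kernel a k z s) \<in> borel_measurable borel"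
proof -
  have [measurable]: "f \<in> borel_measurable borel"
    using assms by (rule borel_measurable_continuous_onI)
  have [measurable]: "(\<lambda>s. exp (of_real (2 * a) * cnj (z - s) * s)) \<in> borel_measurable borel"
    by (intro borel_measurable_continuous_onI continuous_intros)
  show ?thesis unfolding twisted_kernel_def by measurable
qed

lemma integrable_solve_integrand:
  assumes "a > 0" "continuous_on UNIV f" "\<And>w. cmod (f w) \<le> M * exp (a * (cmod w)\<^sup>2)"
  shows "integrable lborel (\<lambda>s. f (z - s) * twisted_kernel a k z s)"
proof (rule Bochner_Integration.integrable_bound)
  show "integrable lborel (\<lambda>s. M * exp (a * (cmod z)\<^sup>2) * gauss_kernel a k s)"
    using integrable_gauss_kernel[OF assms(1)] by simp
  show "AE s in lborel. norm (f (z - s) * twisted_kernel a k z s)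
      \<le> norm (M * exp (a * (cmod z)\<^sup>2) * gauss_kernel a k s)"
    using norm_solve_integrand[OF assms(3)]
    by (intro AE_I2) (metis abs_ge_self order_trans real_norm_def)
qed (use measurable_solve_integrand[OF assms(2)] in simp)

lemma integral_norm_solve_integrand:
  assumes "a > 0" "continuous_on UNIV f" "\<And>w. cmod (f w) \<le> M * exp (a * (cmod w)\<^sup>2)"
  shows "(LINT s|lborel. cmod (f (z - s) * twisted_kernel a k z s))
      \<le> M * (LINT s|lborel. gauss_kernel a k s) * exp (a * (cmod z)\<^sup>2)"
proof -
  have "(LINT s|lborel. cmod (f (z - s) * twisted_kernel a k z s))
      \<le> (LINT s|lborel. M * exp (a * (cmod z)\<^sup>2) * gauss_kernel a k s)"
    using integrable_solve_integrand[OF assms] integrable_gauss_kernel[OF assms(1)]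
    by (intro integral_mono norm_solve_integrand[OF assms(3)]) auto
  then show ?thesis by (simp add: mult_ac)
qed

lemma norm_solve_le:
  assumes "a > 0" "continuous_on UNIV f" "\<And>w. cmod (f w) \<le> M * exp (a * (cmod w)\<^sup>2)"
  shows "cmod (solve a k f z) \<le> (LINT s|lborel. gauss_kernel a k s) * M * exp (a * (cmod z)\<^sup>2)"
proof -
  have "cmod (solve a k f z) \<le> (LINT s|lborel. cmod (f (z - s) * twisted_kernel a k z s))"
    unfolding solve_def by simp
  also note integral_norm_solve_integrand[OF assms]
  finally show ?thesis by (simp add: mult_ac)
qed

lemma continuous_solve:
  assumes a: "a > 0" and f: "continuous_on UNIV f" "\<And>w. cmod (f w) \<le> M * exp (a * (cmod w)\<^sup>2)"
  shows "continuous_on UNIV (solve a k f)"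
  unfolding continuous_on_sequentially
proof (intro ballI allI impI, elim conjE)
  fix x :: "nat \<Rightarrow> complex" and z
  assume x: "x \<longlonglongrightarrow> z"
  then obtain R where R: "\<And>n. cmod (x n) \<le> R"
    using convergent_imp_bounded[of x] by (auto simp: bounded_iff)
  have M: "M \<ge> 0" using f(2)[of 0] order_trans[OF norm_ge_zero[of "f 0"]] by simp
  have "(\<lambda>n. LINT s|lborel. f (x n - s) * twisted_kernel a k (x n) s)
      \<longlonglongrightarrow> (LINT s|lborel. f (z - s) * twisted_kernel a k z s)"
  proof (rule integral_dominated_convergence)
    show "integrable lborel (\<lambda>s. M * exp (a * R\<^sup>2) * gauss_kernel a k s)"
      using integrable_gauss_kernel[OF a] by simp
    show "AE s in lborel. norm (f (x n - s) * twisted_kernel a k (x n) s)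
        \<le> M * exp (a * R\<^sup>2) * gauss_kernel a k s" for n
    proof (rule AE_I2)
      fix s
      have "(cmod (x n))\<^sup>2 \<le> R\<^sup>2" using R[of n] by (intro power_mono) auto
      then have "M * exp (a * (cmod (x n))\<^sup>2) * gauss_kernel a k s \<le> M * exp (a * R\<^sup>2) * gauss_kernel a k s"
        using M a by (intro mult_right_mono mult_left_mono) (auto simp: gauss_kernel_nonneg)
      then show "norm (f (x n - s) * twisted_kernel a k (x n) s) \<le> M * exp (a * R\<^sup>2) * gauss_kernel a k s"
        using norm_solve_integrand[OF f(2)] order_trans by blast
    qed
    show "AE s in lborel. (\<lambda>n. f (x n - s) * twisted_kernel a k (x n) s)
        \<longlonglongrightarrow> f (z - s) * twisted_kernel a k z s"
    proof (rule AE_I2)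
      fix s
      have "isCont f (z - s)" using f(1) by (simp add: continuous_on_eq_continuous_at)
      then have "(\<lambda>n. f (x n - s)) \<longlonglongrightarrow> f (z - s)"
        by (rule isCont_tendsto_compose) (intro tendsto_intros x)
      moreover have "(\<lambda>n. twisted_kernel a k (x n) s) \<longlonglongrightarrow> twisted_kernel a k z s"
      proof -
        have "(\<lambda>n. s ^ k * exp (of_real (2 * a) * cnj (x n - s) * s) * inverse s)
            \<longlonglongrightarrow> s ^ k * exp (of_real (2 * a) * cnj (z - s) * s) * inverse s"
          by (intro tendsto_intros x)
        then show ?thesis by (simp only: twisted_kernel_def divide_inverse)
      qed
      ultimately show "(\<lambda>n. f (x n - s) * twisted_kernel a k (x n) s)
          \<longlonglongrightarrow> f (z - s) * twisted_kernel a k z s" by (rule tendsto_mult)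
    qed
  qed (use measurable_solve_integrand[OF f(1)] in simp_all)
  then show "(solve a k f \<circ> x) \<longlonglongrightarrow> solve a k f z" by (simp add: o_def solve_def)
qed

text \<open>In terms of partial derivatives: \<open>\<partial>\<^sub>x\<close> of \<open>solve a k f\<close> is \<open>solve a k (\<partial>\<^sub>x f) + 2 a solve a (k + 1) f\<close>, and for
\<open>\<partial>\<^sub>y\<close> the second term gets the factor \<open>- \<i>\<close>, since \<open>\<partial>\<^sub>y (cnj z) = - \<i>\<close>.\<close>

lemma has_derivative_solve:
  assumes a: "a > 0" and f: "gauss_bounded a (Suc l) M f"
  shows "(solve a k f has_derivative (\<lambda>h. of_real (Re h) * solve a k (partial_x f) z
      + of_real (Im h) * solve a k (partial_y f) z
      + of_real (2 * a) * cnj h * solve a (Suc k) f z)) (at z)"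
proof -
  have fd: "f differentiable (at w)" for w using f by simp
  have fx: "gauss_bounded a l M (partial_x f)" and fy: "gauss_bounded a l M (partial_y f)"
    using f by simp_all
  have M: "M \<ge> 0" using gauss_bounded_nonneg[OF f] .
  note bds = gauss_boundedD[OF f] gauss_boundedD[OF fx] gauss_boundedD[OF fy]
  note cont = gauss_bounded_continuous[OF f] gauss_bounded_continuous[OF fx] gauss_bounded_continuous[OF fy]
  note ints = integrable_solve_integrand[OF a cont(1) bds(1)] integrable_solve_integrand[OF a cont(2) bds(2)]
    integrable_solve_integrand[OF a cont(3) bds(3)]
  define g where "g z s = f (z - s) * twisted_kernel a k z s" for z s
  define g' where "g' z s h = of_real (Re h) * (partial_x f (z - s) * twisted_kernel a k z s)
      + of_real (Im h) * (partial_y f (z - s) * twisted_kernel a k z s)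
      + of_real (2 * a) * cnj h * (f (z - s) * twisted_kernel a (Suc k) z s)" for z s h
  \<comment> \<open>\<open>E\<close> bounds the weight \<open>exp (a \<bar>w\<bar>\<^sup>2)\<close> uniformly on the unit disc around \<open>z\<close>.\<close>
  define E where "E = exp (a * (cmod z + 1)\<^sup>2)"
  define B where "B s = 2 * M * E * gauss_kernel a k s + 2 * a * M * E * gauss_kernel a (Suc k) s" for s
  have "((\<lambda>z. LINT s|lborel. g z s) has_derivative (\<lambda>h. LINT s|lborel. g' z s h)) (at z)"
  proof (rule has_derivative_lebesgue_integral[where r = 1 and B = B])
    show "integrable lborel (g w)" for w
      unfolding g_def using ints(1) .
    show "integrable lborel B"
      unfolding B_def using integrable_gauss_kernel[OF a] by simp
    show "integrable lborel (\<lambda>s. g' z s h)" for h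
      unfolding g'_def using ints by (intro Bochner_Integration.integrable_add integrable_mult_right)
    show "((\<lambda>z. g z s) has_derivative g' w s) (at w)" for w s
    proof -
      have 1: "((\<lambda>z. f (z - s)) has_derivative
          (\<lambda>h. Re h *\<^sub>R partial_x f (w - s) + Im h *\<^sub>R partial_y f (w - s))) (at w)"
      proof -
        have "((\<lambda>z. z - s) has_derivative (\<lambda>h. h)) (at w)" by (auto intro!: derivative_eq_intros)
        from has_derivative_compose[OF this has_derivative_partials[OF fd]] show ?thesis .
      qed
      have lin: "((\<lambda>z. of_real (2 * a) * cnj (z - s) * s) has_derivative (\<lambda>h. of_real (2 * a) * cnj h * s)) (at w)"
        by (auto intro!: derivative_eq_intros bounded_linear.has_derivative[OF bounded_linear_cnj])
      have 2: "((\<lambda>z. exp (of_real (2 * a) * cnj (z - s) * s)) has_derivative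
          (\<lambda>h. (of_real (2 * a) * cnj h * s) * exp (of_real (2 * a) * cnj (w - s) * s))) (at w)"
        using has_derivative_compose[OF lin DERIV_exp[THEN has_field_derivative_imp_has_derivative]]
        by (simp add: mult.commute)
      have "((\<lambda>z. f (z - s) * (s ^ k * exp (of_real (2 * a) * cnj (z - s) * s) * inverse s)) has_derivative
         (\<lambda>h. f (w - s) * (s ^ k * ((of_real (2 * a) * cnj h * s) * exp (of_real (2 * a) * cnj (w - s) * s)) * inverse s)
           + (Re h *\<^sub>R partial_x f (w - s) + Im h *\<^sub>R partial_y f (w - s)) *
             (s ^ k * exp (of_real (2 * a) * cnj (w - s) * s) * inverse s))) (at w)"
        by (intro has_derivative_mult 1 has_derivative_mult_left has_derivative_mult_right 2)
      then have "((\<lambda>z. g z s) has_derivative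
         (\<lambda>h. f (w - s) * (s ^ k * ((of_real (2 * a) * cnj h * s) * exp (of_real (2 * a) * cnj (w - s) * s)) * inverse s)
           + (Re h *\<^sub>R partial_x f (w - s) + Im h *\<^sub>R partial_y f (w - s)) *
             (s ^ k * exp (of_real (2 * a) * cnj (w - s) * s) * inverse s))) (at w)"
        by (simp only: g_def twisted_kernel_def divide_inverse)
      then show ?thesis
        by (rule has_derivative_eq_rhs)
          (simp add: g'_def twisted_kernel_def divide_inverse fun_eq_iff scaleR_conv_of_real algebra_simps)
    qed
    show "norm (g' w s h) \<le> B s * norm h" if "w \<in> ball z 1" for w s h
    proof -
      have "cmod w \<le> cmod z + 1"
        using that norm_triangle_sub[of w z] by (simp add: dist_norm norm_minus_commute)
      then have "(cmod w)\<^sup>2 \<le> (cmod z + 1)\<^sup>2" by (intro power_mono) auto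
      then have "exp (a * (cmod w)\<^sup>2) \<le> E" using a by (simp add: E_def)
      then have le: "M * exp (a * (cmod w)\<^sup>2) * gauss_kernel a j s \<le> M * E * gauss_kernel a j s" for j
        using M by (intro mult_right_mono mult_left_mono) (auto simp: gauss_kernel_nonneg)
      note b = order_trans[OF norm_solve_integrand[OF bds(1)] le]
        order_trans[OF norm_solve_integrand[OF bds(2)] le] order_trans[OF norm_solve_integrand[OF bds(3)] le]
      have "norm (g' w s h) \<le> \<bar>Re h\<bar> * cmod (partial_x f (w - s) * twisted_kernel a k w s)
        + \<bar>Im h\<bar> * cmod (partial_y f (w - s) * twisted_kernel a k w s)
        + 2 * a * cmod h * cmod (f (w - s) * twisted_kernel a (Suc k) w s)"
        unfolding g'_def
        by (rule order_trans[OF norm_triangle_ineq], rule add_mono,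
            rule order_trans[OF norm_triangle_ineq], rule add_mono)
          (use a in \<open>simp_all add: norm_mult\<close>)
      also have "\<dots> \<le> cmod h * (M * E * gauss_kernel a k s) + cmod h * (M * E * gauss_kernel a k s)
        + 2 * a * cmod h * (M * E * gauss_kernel a (Suc k) s)"
        using a by (intro add_mono mult_mono b abs_Re_le_cmod abs_Im_le_cmod) auto
      finally show ?thesis by (simp add: B_def algebra_simps)
    qed
  qed simp
  then show ?thesis
    unfolding g_def g'_def solve_def[abs_def] using ints by simp
qed

text \<open>Boundedness of the solution operator, by induction on the number of derivatives with \<open>k\<close> arbitrary. The
exponent \<open>a\<close> is the same on both sides.\<close>

lemma solve_gauss_bounded:
  assumes a: "a > 0"
  shows "\<exists>C\<ge>0. \<forall>M f. gauss_bounded a l M f \<longrightarrow> gauss_bounded a l (C * M) (solve a k f)"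
proof (induction l arbitrary: k)
  case 0
  let ?C = "LINT s|lborel. gauss_kernel a k s"
  have "gauss_bounded a 0 (?C * M) (solve a k f)" if "gauss_bounded a 0 M f" for M f
    using that continuous_solve[OF a, of f M k] norm_solve_le[OF a, of f M k] by simp
  moreover have "?C \<ge> 0" by (simp add: gauss_kernel_nonneg)
  ultimately show ?case by blast
next
  case (Suc l)
  obtain C1 where C1: "C1 \<ge> 0" "\<And>M f. gauss_bounded a l M f \<Longrightarrow> gauss_bounded a l (C1 * M) (solve a k f)"
    using Suc.IH by blast
  obtain C2 where C2: "C2 \<ge> 0" "\<And>M f. gauss_bounded a l M f \<Longrightarrow> gauss_bounded a l (C2 * M) (solve a (Suc k) f)"
    using Suc.IH by blast
  define C0 where "C0 = (LINT s|lborel. gauss_kernel a k s)"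
  have C0: "C0 \<ge> 0" by (simp add: C0_def gauss_kernel_nonneg)
  define C where "C = C0 + C1 + 2 * a * C2"
  have "gauss_bounded a (Suc l) (C * M) (solve a k f)" if f: "gauss_bounded a (Suc l) M f" for M f
  proof -
    have M: "M \<ge> 0" using gauss_bounded_nonneg[OF f] .
    have fx: "gauss_bounded a l M (partial_x f)" and fy: "gauss_bounded a l M (partial_y f)"
      using f by simp_all
    note D = has_derivative_solve[OF a f, of k]
    have px: "partial_x (solve a k f) = (\<lambda>z. 1 * solve a k (partial_x f) z + of_real (2 * a) * solve a (Suc k) f z)"
      using partials_eqI(1)[OF D] by (simp add: fun_eq_iff)
    have py: "partial_y (solve a k f) = (\<lambda>z. 1 * solve a k (partial_y f) z + (- \<i> * of_real (2 * a)) * solve a (Suc k) f z)"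
      using partials_eqI(2)[OF D] by (simp add: fun_eq_iff)
    have le: "C1 * M + 2 * a * (C2 * M) \<le> C * M"
      using M C0 by (simp add: C_def algebra_simps)
    have "gauss_bounded a l (C * M) (partial_x (solve a k f))"
      unfolding px
      using gauss_bounded_mono[OF gauss_bounded_linear_combination[OF C1(2)[OF fx]
          C2(2)[OF gauss_bounded_Suc_lower[OF f]], of 1 "of_real (2 * a)"] order_refl, of "C * M"] le a
      by (simp add: norm_mult)
    moreover have "gauss_bounded a l (C * M) (partial_y (solve a k f))"
      unfolding py
      using gauss_bounded_mono[OF gauss_bounded_linear_combination[OF C1(2)[OF fy]
          C2(2)[OF gauss_bounded_Suc_lower[OF f]], of 1 "- \<i> * of_real (2 * a)"] order_refl, of "C * M"] le a
      by (simp add: norm_mult)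
    moreover have "solve a k f differentiable (at z)" for z
      using D by (auto simp: differentiable_def)
    moreover have "cmod (solve a k f z) \<le> C * M * exp (a * (cmod z)\<^sup>2)" for z
    proof -
      have "cmod (solve a k f z) \<le> C0 * M * exp (a * (cmod z)\<^sup>2)"
        unfolding C0_def using gauss_bounded_continuous[OF f] gauss_boundedD[OF f] by (rule norm_solve_le[OF a])
      also have "\<dots> \<le> C * M * exp (a * (cmod z)\<^sup>2)"
        using M C1(1) C2(1) a by (intro mult_right_mono) (auto simp: C_def)
      finally show ?thesis .
    qed
    ultimately show ?thesis by simp
  qed
  moreover have "C \<ge> 0" using C0 C1(1) C2(1) a by (simp add: C_def)
  ultimately show ?case by blast
qed

section \<open>The Cauchy-Pompeiu formula\<close>

lemma partials_zero_outside:
  assumes supp: "\<And>z. R \<le> cmod z \<Longrightarrow> F z = 0" and z: "R < cmod z"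
  shows "partial_x F z = 0" "partial_y F z = 0"
proof -
  have "(F has_derivative (\<lambda>h. 0)) (at z)"
  proof (rule has_derivative_transform_within_open)
    show "((\<lambda>z. 0) has_derivative (\<lambda>h. 0)) (at z)" by simp
    show "open {z. R < cmod z}" by (intro open_Collect_less continuous_intros)
  qed (use supp z in auto)
  from partials_eqI[OF this] show "partial_x F z = 0" "partial_y F z = 0" by simp_all
qed

lemma bounded_compact_support:
  fixes F :: "complex \<Rightarrow> complex"
  assumes "continuous_on UNIV F" and supp: "\<And>z. R < cmod z \<Longrightarrow> F z = 0"
  obtains M where "M \<ge> 0" "\<And>z. cmod (F z) \<le> M"
proof -
  have "compact (F ` cball 0 R)"
    using assms(1) by (intro compact_continuous_image) (auto intro: continuous_on_subset)
  then obtain B where B: "\<And>z. cmod z \<le> R \<Longrightarrow> cmod (F z) \<le> B"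
    by (fastforce simp: bounded_iff dest: compact_imp_bounded)
  have "cmod (F z) \<le> max 0 B" for z
    using B[of z] supp[of z] by (cases "cmod z \<le> R") (auto simp: le_max_iff_disj)
  then show ?thesis using that[of "max 0 B"] by simp
qed

lemma integrable_compact_support:
  fixes F :: "complex \<Rightarrow> complex"
  assumes "continuous_on UNIV F" and supp: "\<And>z. R < cmod z \<Longrightarrow> F z = 0"
  shows "integrable lborel F"
proof -
  have "integrable lborel (\<lambda>z. indicator (cball 0 R) z *\<^sub>R F z)"
    using assms(1) by (intro borel_integrable_compact) (auto intro: continuous_on_subset)
  moreover have "(\<lambda>z. indicator (cball 0 R) z *\<^sub>R F z) = F"
    using supp by (auto simp: indicator_def fun_eq_iff)
  ultimately show ?thesis by simp
qed

text \<open>Differentiate the constant function \<open>x \<mapsto> \<integral> F (x + t) dt\<close> under the integral sign.\<close>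

lemma integral_dbar_eq_0:
  assumes F: "C_fun 1 F" and supp: "\<And>z. R \<le> cmod z \<Longrightarrow> F z = 0"
  shows "(LINT z|lborel. dbar F z) = 0"
proof -
  have Fd: "F differentiable (at z)" for z using F by simp
  have cF: "continuous_on UNIV F" using F C_fun_continuous by blast
  have cx: "continuous_on UNIV (partial_x F)" and cy: "continuous_on UNIV (partial_y F)" using F by simp_all
  note px = partials_zero_outside(1)[of R F, OF supp] and py = partials_zero_outside(2)[of R F, OF supp]
  obtain Mx where Mx: "Mx \<ge> 0" "\<And>z. cmod (partial_x F z) \<le> Mx" using bounded_compact_support[OF cx px] by blast
  obtain My where My: "My \<ge> 0" "\<And>z. cmod (partial_y F z) \<le> My" using bounded_compact_support[OF cy py] by blast
  have int: "integrable lborel F" by (rule integrable_compact_support[OF cF, of R]) (use supp in simp)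
  have intx: "integrable lborel (partial_x F)" using integrable_compact_support[OF cx px] .
  have inty: "integrable lborel (partial_y F)" using integrable_compact_support[OF cy py] .
  define D where "D z h = Re h *\<^sub>R partial_x F z + Im h *\<^sub>R partial_y F z" for z h
  have "((\<lambda>x. LINT t|lborel. F (x + t)) has_derivative (\<lambda>h. LINT t|lborel. D (0 + t) h)) (at 0)"
  proof (rule has_derivative_lebesgue_integral[where r = 1 and B = "\<lambda>t. (Mx + My) * indicator (cball 0 (R + 1)) t"])
    show "integrable lborel (\<lambda>t. F (x + t))" for x
      using lborel_integrable_complex_affine[OF _ int, of 1 x] by simp
    show "((\<lambda>x. F (x + t)) has_derivative D (x + t)) (at x)" for x t
    proof -
      have "((\<lambda>x. x + t) has_derivative (\<lambda>h. h)) (at x)" by (auto intro!: derivative_eq_intros)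
      from has_derivative_compose[OF this has_derivative_partials[OF Fd]] show ?thesis
        by (simp add: D_def[abs_def])
    qed
    show "norm (D (x + t) h) \<le> (Mx + My) * indicator (cball 0 (R + 1)) t * norm h"
      if x: "x \<in> ball 0 1" for x t h
    proof (cases "cmod t \<le> R + 1")
      case True
      have "norm (D (x + t) h) \<le> \<bar>Re h\<bar> * cmod (partial_x F (x + t)) + \<bar>Im h\<bar> * cmod (partial_y F (x + t))"
        unfolding D_def by (rule order_trans[OF norm_triangle_ineq]) simp
      also have "\<dots> \<le> cmod h * Mx + cmod h * My"
        by (intro add_mono mult_mono abs_Re_le_cmod abs_Im_le_cmod Mx My) auto
      finally show ?thesis using True by (simp add: algebra_simps)
    next
      case False
      have "cmod t \<le> cmod (x + t) + cmod x" using norm_triangle_ineq4[of "x + t" x] by simp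
      then have "R < cmod (x + t)" using x False by simp
      then show ?thesis using px py Mx(1) My(1) by (simp add: D_def)
    qed
    show "integrable lborel (\<lambda>t::complex. (Mx + My) * indicator (cball 0 (R + 1)) t)"
      using emeasure_bounded_finite[of "cball (0::complex) (R + 1)"]
      by (intro integrable_mult_right integrable_real_indicator) auto
    show "integrable lborel (\<lambda>t. D (0 + t) h)" for h
      unfolding D_def using intx inty by simp
  qed simp
  moreover have "(LINT t|lborel. F (x + t)) = (LINT t|lborel. F t)" for x
    using lborel_integral_complex_affine[of 1 F x] int by (simp add: borel_measurable_integrable)
  ultimately have "((\<lambda>x. LINT t|lborel. F t) has_derivative (\<lambda>h. LINT t|lborel. D t h)) (at (0::complex))" by simp
  from has_derivative_unique[OF this has_derivative_const]
  have "(LINT t|lborel. D t h) = 0" for h by metis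
  from this[of 1] this[of \<i>]
  have "(LINT t|lborel. partial_x F t) = 0" "(LINT t|lborel. partial_y F t) = 0" by (simp_all add: D_def)
  then show ?thesis using intx inty by (simp add: dbar_def)
qed

text \<open>The integral of the \<open>\<partial>\<close>-bar derivative \<open>\<epsilon> / (\<bar>s\<bar>\<^sup>2 + \<epsilon>)\<^sup>2\<close> of the regularized kernel
\<open>cnj s / (\<bar>s\<bar>\<^sup>2 + \<epsilon>)\<close>, rescaled to \<open>\<epsilon> = 1\<close>. It is the constant \<open>\<pi>\<close> of the Cauchy-Pompeiu formula.\<close>

definition cauchy_mass :: real where
  "cauchy_mass = (LINT s|lborel. 1 / (1 + (cmod s)\<^sup>2)\<^sup>2)"

lemma cauchy_mass_integrand_le_rho:
  assumes "s \<noteq> 0"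
  shows "1 / (1 + (cmod s)\<^sup>2)\<^sup>2 \<le> rho s"
proof -
  let ?r = "cmod s"
  have "?r \<le> 1 + ?r\<^sup>2"
  proof -
    have "2 * ?r \<le> 1 + ?r\<^sup>2"
      using zero_le_power2[of "?r - 1"] by (simp add: power2_diff)
    moreover have "x \<le> c" if "2 * x \<le> c" "0 \<le> x" for x c :: real using that by simp
    ultimately show ?thesis by (metis norm_ge_zero)
  qed
  then have "?r * (1 + ?r\<^sup>2) \<le> (1 + ?r\<^sup>2) * (1 + ?r\<^sup>2)" by (intro mult_right_mono) auto
  moreover have "0 < ?r * (1 + ?r\<^sup>2)" using assms by (intro mult_pos_pos) (auto intro: add_pos_nonneg)
  ultimately show ?thesis
    unfolding rho_def power2_eq_square[of "1 + ?r\<^sup>2"]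
    by (simp only: inverse_eq_divide[symmetric] le_imp_inverse_le)
qed

lemma cauchy_mass_pos: "cauchy_mass > 0"
proof -
  let ?g = "\<lambda>s::complex. 1 / (1 + (cmod s)\<^sup>2)\<^sup>2"
  have int: "integrable lborel ?g"
    by (rule integrable_le_rho[where C = 1]) (use cauchy_mass_integrand_le_rho in auto)
  have pos: "?g s > 0" for s
    by (intro divide_pos_pos zero_less_power add_pos_nonneg) auto
  have "cauchy_mass \<noteq> 0"
  proof
    assume "cauchy_mass = 0"
    then have "AE s in lborel. ?g s = 0"
      using integral_nonneg_eq_0_iff_AE[OF int] pos unfolding cauchy_mass_def by (simp add: less_imp_le)
    then have "AE s in (lborel :: complex measure). False"
      by eventually_elim (use pos in \<open>metis less_irrefl\<close>)
    then have "emeasure (lborel :: complex measure) UNIV = 0"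
      by (simp add: AE_iff_measurable[of UNIV])
    then show False by simp
  qed
  moreover have "cauchy_mass \<ge> 0" unfolding cauchy_mass_def using pos by (simp add: less_imp_le)
  ultimately show ?thesis by simp
qed

lemma regularized_cauchy_kernel:
  fixes \<epsilon> :: real
  assumes "\<epsilon> > 0"
  defines "k \<equiv> (\<lambda>s. cnj s / of_real ((cmod s)\<^sup>2 + \<epsilon>))"
  shows "k differentiable (at s)"
    and "dbar k s = of_real (\<epsilon> / ((cmod s)\<^sup>2 + \<epsilon>)\<^sup>2)"
    and "continuous_on UNIV (partial_x k)" "continuous_on UNIV (partial_y k)"
proof -
  have pos: "(Re s)\<^sup>2 + (Im s)\<^sup>2 + \<epsilon> > 0" for s using assms by (simp add: add_nonneg_pos)
  then have nz: "complex_of_real ((Re s)\<^sup>2 + (Im s)\<^sup>2 + \<epsilon>) \<noteq> 0" for s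
    by (metis less_irrefl of_real_eq_0_iff)
  define N where "N s = complex_of_real ((Re s)\<^sup>2 + (Im s)\<^sup>2 + \<epsilon>)" for s
  have Nd: "(N has_derivative (\<lambda>h. of_real (2 * (Re s * Re h + Im s * Im h)))) (at s)" for s
    unfolding N_def
    by (auto intro!: derivative_eq_intros simp: fun_eq_iff algebra_simps)
  have D: "(k has_derivative (\<lambda>h. (cnj h * N s - cnj s * of_real (2 * (Re s * Re h + Im s * Im h))) / (N s * N s))) (at s)" for s
  proof -
    have "((\<lambda>s. cnj s / N s) has_derivative (\<lambda>h. (cnj h * N s - cnj s * of_real (2 * (Re s * Re h + Im s * Im h))) / (N s * N s))) (at s)"
      by (rule has_derivative_divide'[OF bounded_linear.has_derivative[OF bounded_linear_cnj has_derivative_ident] Nd])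
        (use nz in \<open>simp add: N_def\<close>)
    then show ?thesis by (simp add: k_def N_def cmod_power2)
  qed
  show "k differentiable (at s)" using D by (auto simp: differentiable_def)
  have px: "partial_x k = (\<lambda>s. (N s - cnj s * of_real (2 * Re s)) / (N s * N s))"
    using partials_eqI(1)[OF D] by (simp add: fun_eq_iff)
  have py: "partial_y k = (\<lambda>s. (- \<i> * N s - cnj s * of_real (2 * Im s)) / (N s * N s))"
    using partials_eqI(2)[OF D] by (simp add: fun_eq_iff)
  have cN: "continuous_on UNIV N" unfolding N_def by (intro continuous_intros)
  have nz': "N s * N s \<noteq> 0" for s using nz by (simp add: N_def)
  show "continuous_on UNIV (partial_x k)" "continuous_on UNIV (partial_y k)"
    unfolding px py using nz' by (auto intro!: continuous_intros cN)
  have "dbar k s = (2 * N s - 2 * (cnj s * s)) / (2 * (N s * N s))"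
  proof -
    have "cnj s * s * 2 = cnj s * of_real (2 * Re s) + \<i> * (cnj s * of_real (2 * Im s))"
      by (simp add: complex_eq_iff algebra_simps)
    moreover have "\<i> * (- \<i> * N s - cnj s * of_real (2 * Im s)) = N s - \<i> * (cnj s * of_real (2 * Im s))"
      by (simp add: algebra_simps)
    ultimately have "(N s - cnj s * of_real (2 * Re s)) + \<i> * (- \<i> * N s - cnj s * of_real (2 * Im s))
        = 2 * N s - 2 * (cnj s * s)" by (simp only:) (simp add: algebra_simps)
    then have "((N s - cnj s * of_real (2 * Re s)) + \<i> * (- \<i> * N s - cnj s * of_real (2 * Im s))) / (N s * N s) / 2
        = (2 * N s - 2 * (cnj s * s)) / (N s * N s) / 2" by (simp only:)
    then show ?thesis
      unfolding dbar_def px py by (simp only: add_divide_distrib times_divide_eq_right divide_divide_eq_left mult.commute[of "N s * N s"])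
  qed
  also have "2 * N s - 2 * (cnj s * s) = 2 * of_real \<epsilon>"
    by (simp add: N_def complex_eq_iff power2_eq_square)
  finally show "dbar k s = of_real (\<epsilon> / ((cmod s)\<^sup>2 + \<epsilon>)\<^sup>2)"
  proof -
    have "N s = of_real ((cmod s)\<^sup>2 + \<epsilon>)" by (simp add: N_def cmod_power2)
    then have "N s * N s = of_real (((cmod s)\<^sup>2 + \<epsilon>)\<^sup>2)"
      by (simp only: power2_eq_square[of "(cmod s)\<^sup>2 + \<epsilon>"] of_real_mult)
    then show "dbar k s = (2 * of_real \<epsilon>) / (2 * (N s * N s)) \<Longrightarrow> ?thesis"
      by (simp only: of_real_divide mult_divide_mult_cancel_left_if) simp
  qed
qed

lemma partials_mult:
  assumes "f differentiable (at z)" "g differentiable (at z)"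
  shows "(\<lambda>z. f z * g z) differentiable (at z)"
    and "partial_x (\<lambda>z. f z * g z) z = f z * partial_x g z + partial_x f z * g z"
    and "partial_y (\<lambda>z. f z * g z) z = f z * partial_y g z + partial_y f z * g z"
proof -
  note D = has_derivative_mult[OF has_derivative_partials[OF assms(1)] has_derivative_partials[OF assms(2)]]
  show "(\<lambda>z. f z * g z) differentiable (at z)" using D by (auto simp: differentiable_def)
  show "partial_x (\<lambda>z. f z * g z) z = f z * partial_x g z + partial_x f z * g z"
    "partial_y (\<lambda>z. f z * g z) z = f z * partial_y g z + partial_y f z * g z"
    using partials_eqI[OF D] by simp_all
qed

text \<open>Integrate \<open>\<partial>\<close>-bar of the product of \<open>f\<close> and the regularized kernel with \<open>\<epsilon> = t\<^sup>2\<close>, and rescale by \<open>t\<close>.\<close>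

lemma regularized_cauchy_pompeiu:
  assumes f: "C_fun 1 f" and supp: "\<And>z. R \<le> cmod z \<Longrightarrow> f z = 0" and "t > 0"
  shows "(LINT s|lborel. dbar f s * (cnj s / of_real ((cmod s)\<^sup>2 + t\<^sup>2)))
    = - (LINT s|lborel. f (of_real t * s) * of_real (1 / (1 + (cmod s)\<^sup>2)\<^sup>2))"
proof -
  define k where "k s = cnj s / complex_of_real ((cmod s)\<^sup>2 + t\<^sup>2)" for s
  have t2: "t\<^sup>2 > 0" using \<open>t > 0\<close> by simp
  note k = regularized_cauchy_kernel[OF t2, folded k_def[abs_def]]
  have fd: "f differentiable (at z)" for z using f by simp
  note P = partials_mult[OF fd k(1)]
  have cf: "continuous_on UNIV f" using f C_fun_continuous by blast
  have cx: "continuous_on UNIV (partial_x f)" and cy: "continuous_on UNIV (partial_y f)" using f by simp_all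
  have ck: "continuous_on UNIV k"
    using k(1) by (auto simp: continuous_on_eq_continuous_at intro: differentiable_imp_continuous_within)
  have CF: "C_fun 1 (\<lambda>s. f s * k s)"
    using P(1) by (auto simp: P(2,3)[abs_def] intro!: continuous_intros cf cx cy ck k(3,4))
  define g where "g s = t\<^sup>2 / ((cmod s)\<^sup>2 + t\<^sup>2)\<^sup>2" for s
  have dbarF: "dbar (\<lambda>s. f s * k s) s = f s * of_real (g s) + dbar f s * k s" for s
  proof -
    have "dbar (\<lambda>s. f s * k s) s = f s * dbar k s + dbar f s * k s"
      unfolding dbar_def P(2,3) by (simp add: field_simps)
    then show ?thesis by (simp only: k(2) g_def)
  qed
  have "(LINT s|lborel. f s * of_real (g s) + dbar f s * k s) = 0"
    using integral_dbar_eq_0[OF CF, of R] supp by (simp add: dbarF)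
  moreover have cg: "continuous_on UNIV (\<lambda>s. f s * of_real (g s))"
    unfolding g_def using t2 by (intro continuous_intros cf) (auto simp: add_nonneg_eq_0_iff)
  have "integrable lborel (\<lambda>s. f s * of_real (g s))"
    by (rule integrable_compact_support[OF cg, of R]) (use supp in auto)
  moreover have "integrable lborel (\<lambda>s. dbar f s * k s)"
    using partials_zero_outside[of R f, OF supp]
    by (intro integrable_compact_support[of _ R])
      (auto simp: dbar_def intro!: continuous_intros cx cy ck)
  ultimately have "(LINT s|lborel. dbar f s * k s) = - (LINT s|lborel. f s * of_real (g s))"
    by (simp add: add_eq_0_iff)
  also have "(LINT s|lborel. f s * of_real (g s)) =
      of_real (t\<^sup>2) * (LINT s|lborel. f (0 + of_real t * s) * of_real (g (0 + of_real t * s)))"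
    using \<open>t > 0\<close> cg by (intro lborel_integral_complex_affine) (auto intro: borel_measurable_continuous_onI)
  also have "\<dots> = (LINT s|lborel. f (of_real t * s) * of_real (t\<^sup>2 * g (of_real t * s)))"
    by (simp add: mult_ac flip: integral_mult_right_zero)
  also have "\<dots> = (LINT s|lborel. f (of_real t * s) * of_real (1 / (1 + (cmod s)\<^sup>2)\<^sup>2))"
  proof -
    have "t\<^sup>2 * g (of_real t * s) = 1 / (1 + (cmod s)\<^sup>2)\<^sup>2" for s
    proof -
      have "(cmod (of_real t * s))\<^sup>2 + t\<^sup>2 = t\<^sup>2 * (1 + (cmod s)\<^sup>2)"
        by (simp add: norm_mult power_mult_distrib algebra_simps)
      then have "t\<^sup>2 * g (of_real t * s) = t\<^sup>2 * (t\<^sup>2 / (t\<^sup>2 * (1 + (cmod s)\<^sup>2))\<^sup>2)" by (simp only: g_def)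
      also have "x * (x / (x * y)\<^sup>2) = 1 / y\<^sup>2" if "x > 0" for x y :: real
        using that by (simp add: power_mult_distrib power2_eq_square)
      from this[OF t2] have "t\<^sup>2 * (t\<^sup>2 / (t\<^sup>2 * (1 + (cmod s)\<^sup>2))\<^sup>2) = 1 / (1 + (cmod s)\<^sup>2)\<^sup>2" .
      finally show ?thesis .
    qed
    then show ?thesis by simp
  qed
  finally show ?thesis by (simp add: k_def)
qed

text \<open>Let \<open>t\<close> tend to \<open>0\<close> in the regularized formula. Both limits are dominated by multiples of \<^const>\<open>rho\<close>.\<close>

lemma cauchy_pompeiu_0:
  assumes f: "C_fun 1 f" and supp: "\<And>z. R \<le> cmod z \<Longrightarrow> f z = 0"
  shows "(LINT s|lborel. dbar f s / s) = - of_real cauchy_mass * f 0"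
proof -
  define t where "t n = inverse (real (Suc n))" for n
  have t: "t n > 0" for n by (simp add: t_def)
  have t0: "t \<longlonglongrightarrow> 0" unfolding t_def using LIMSEQ_inverse_real_of_nat by simp
  have cf: "continuous_on UNIV f" using f C_fun_continuous by blast
  have cd: "continuous_on UNIV (dbar f)"
    using f unfolding dbar_def by (auto intro!: continuous_intros)
  have fm [measurable]: "f \<in> borel_measurable borel" and dm [measurable]: "dbar f \<in> borel_measurable borel"
    using cf cd by (auto intro: borel_measurable_continuous_onI)
  have [measurable]: "(\<lambda>s. cnj s / of_real ((cmod s)\<^sup>2 + (t n)\<^sup>2)) \<in> borel_measurable borel" for n
    using regularized_cauchy_kernel(1)[of "(t n)\<^sup>2"] t[of n]
    by (intro borel_measurable_continuous_onI)
      (auto simp: continuous_on_eq_continuous_at simp del: of_real_add intro!: differentiable_imp_continuous_within)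
  have d0: "dbar f z = 0" if "R < cmod z" for z
    using partials_zero_outside[of R f, OF supp that] by (simp add: dbar_def)
  obtain M where M: "M \<ge> 0" "\<And>z. cmod (f z) \<le> M"
    using bounded_compact_support[OF cf, of R] supp by (metis less_imp_le)
  obtain M' where M': "M' \<ge> 0" "\<And>z. cmod (dbar f z) \<le> M'"
    using bounded_compact_support[OF cd d0] by blast
  have lim1: "(\<lambda>n. LINT s|lborel. dbar f s * (cnj s / of_real ((cmod s)\<^sup>2 + (t n)\<^sup>2)))
      \<longlonglongrightarrow> (LINT s|lborel. dbar f s / s)"
  proof (rule integral_dominated_convergence[where w = "\<lambda>s. M' * (1 + R\<^sup>2) * rho s"])
    show "integrable lborel (\<lambda>s. M' * (1 + R\<^sup>2) * rho s)" using integrable_rho by simp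
    show "AE s in lborel. (\<lambda>n. dbar f s * (cnj s / of_real ((cmod s)\<^sup>2 + (t n)\<^sup>2))) \<longlonglongrightarrow> dbar f s / s"
      using AE_lborel_singleton[of 0]
    proof eventually_elim
      case (elim s)
      have "(\<lambda>n. dbar f s * (cnj s / of_real ((cmod s)\<^sup>2 + (t n)\<^sup>2)))
          \<longlonglongrightarrow> dbar f s * (cnj s / of_real ((cmod s)\<^sup>2 + 0\<^sup>2))"
        using elim by (intro tendsto_intros t0) auto
      moreover have "cnj s / of_real ((cmod s)\<^sup>2 + 0\<^sup>2) = 1 / s"
        using elim by (simp add: complex_norm_square field_simps del: of_real_power)
      ultimately show ?case by (simp only: times_divide_eq_right mult_1_right)
    qed
    show "AE s in lborel. norm (dbar f s * (cnj s / of_real ((cmod s)\<^sup>2 + (t n)\<^sup>2)))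
        \<le> M' * (1 + R\<^sup>2) * rho s" for n
      using AE_lborel_singleton[of 0]
    proof eventually_elim
      case (elim s)
      show ?case
      proof (cases "R < cmod s")
        case True
        then show ?thesis using d0 M' rho_nonneg by simp
      next
        case False
        have "cmod s / ((cmod s)\<^sup>2 + (t n)\<^sup>2) \<le> cmod s / (cmod s)\<^sup>2"
          using elim by (intro divide_left_mono mult_pos_pos) (auto simp: add_pos_nonneg)
        also have "\<dots> = (1 + (cmod s)\<^sup>2) * rho s"
        proof -
          have "1 + (cmod s)\<^sup>2 \<noteq> 0" by (metis add_pos_nonneg less_irrefl zero_le_power2 zero_less_one)
          then show ?thesis using elim by (simp add: rho_def power2_eq_square)
        qed
        also have "\<dots> \<le> (1 + R\<^sup>2) * rho s"
          using False rho_nonneg by (intro mult_right_mono add_left_mono power_mono) auto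
        finally have "cmod (dbar f s) * (cmod s / ((cmod s)\<^sup>2 + (t n)\<^sup>2)) \<le> M' * ((1 + R\<^sup>2) * rho s)"
          using M' by (intro mult_mono) auto
        moreover have "cmod (complex_of_real ((cmod s)\<^sup>2 + (t n)\<^sup>2)) = (cmod s)\<^sup>2 + (t n)\<^sup>2"
          unfolding norm_of_real by simp
        ultimately show ?thesis by (simp add: norm_mult norm_divide mult.assoc del: of_real_add of_real_power)
      qed
    qed
  qed measurable
  have lim2: "(\<lambda>n. LINT s|lborel. f (of_real (t n) * s) * of_real (1 / (1 + (cmod s)\<^sup>2)\<^sup>2))
      \<longlonglongrightarrow> (LINT s|lborel. f (of_real 0 * s) * of_real (1 / (1 + (cmod s)\<^sup>2)\<^sup>2))"
  proof (rule integral_dominated_convergence[where w = "\<lambda>s. M * rho s"])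
    show "integrable lborel (\<lambda>s. M * rho s)" using integrable_rho by simp
    show "AE s in lborel. (\<lambda>n. f (of_real (t n) * s) * of_real (1 / (1 + (cmod s)\<^sup>2)\<^sup>2))
        \<longlonglongrightarrow> f (of_real 0 * s) * of_real (1 / (1 + (cmod s)\<^sup>2)\<^sup>2)"
    proof (rule AE_I2)
      fix s
      have "isCont f (of_real 0 * s)" using cf by (simp add: continuous_on_eq_continuous_at)
      then have "(\<lambda>n. f (of_real (t n) * s)) \<longlonglongrightarrow> f (of_real 0 * s)"
        by (rule isCont_tendsto_compose) (intro tendsto_intros t0)
      then show "(\<lambda>n. f (of_real (t n) * s) * of_real (1 / (1 + (cmod s)\<^sup>2)\<^sup>2))
        \<longlonglongrightarrow> f (of_real 0 * s) * of_real (1 / (1 + (cmod s)\<^sup>2)\<^sup>2)"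
        by (intro tendsto_mult tendsto_const)
    qed
    show "AE s in lborel. norm (f (of_real (t n) * s) * of_real (1 / (1 + (cmod s)\<^sup>2)\<^sup>2)) \<le> M * rho s" for n
      using AE_lborel_singleton[of 0]
    proof eventually_elim
      case (elim s)
      have "cmod (f (of_real (t n) * s)) * (1 / (1 + (cmod s)\<^sup>2)\<^sup>2) \<le> M * rho s"
        using M cauchy_mass_integrand_le_rho[OF elim] by (intro mult_mono) auto
      then show ?case unfolding norm_mult norm_of_real by simp
    qed
  qed measurable
  have "(LINT s|lborel. dbar f s / s)
      = - (LINT s|lborel. f (of_real 0 * s) * of_real (1 / (1 + (cmod s)\<^sup>2)\<^sup>2))"
  proof (rule LIMSEQ_unique[OF lim1])
    have "(LINT s|lborel. dbar f s * (cnj s / of_real ((cmod s)\<^sup>2 + (t n)\<^sup>2)))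
        = - (LINT s|lborel. f (of_real (t n) * s) * of_real (1 / (1 + (cmod s)\<^sup>2)\<^sup>2))" for n
      using f supp t[of n] by (rule regularized_cauchy_pompeiu)
    then show "(\<lambda>n. LINT s|lborel. dbar f s * (cnj s / of_real ((cmod s)\<^sup>2 + (t n)\<^sup>2)))
        \<longlonglongrightarrow> - (LINT s|lborel. f (of_real 0 * s) * of_real (1 / (1 + (cmod s)\<^sup>2)\<^sup>2))"
      using tendsto_minus[OF lim2] by presburger
  qed
  also have "(LINT s|lborel. f (of_real 0 * s) * complex_of_real (1 / (1 + (cmod s)\<^sup>2)\<^sup>2)) = f 0 * of_real cauchy_mass"
    by (simp only: cauchy_mass_def integral_complex_of_real of_real_0 mult_zero_left integral_mult_right_zero)
  finally show ?thesis by simp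
qed

lemma partials_translate:
  assumes "f differentiable (at (z + s))"
  shows "partial_x (\<lambda>s. f (z + s)) s = partial_x f (z + s)"
    "partial_y (\<lambda>s. f (z + s)) s = partial_y f (z + s)" "(\<lambda>s. f (z + s)) differentiable (at s)"
proof -
  have "((\<lambda>s. z + s) has_derivative (\<lambda>h. h)) (at s)" by (auto intro!: derivative_eq_intros)
  note D = has_derivative_compose[OF this has_derivative_partials[OF assms]]
  show "partial_x (\<lambda>s. f (z + s)) s = partial_x f (z + s)"
    "partial_y (\<lambda>s. f (z + s)) s = partial_y f (z + s)"
    using partials_eqI[OF D] by simp_all
  show "(\<lambda>s. f (z + s)) differentiable (at s)" using D by (auto simp: differentiable_def)
qed

lemma cauchy_pompeiu:
  assumes f: "C_fun 1 f" and supp: "\<And>z. R \<le> cmod z \<Longrightarrow> f z = 0"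
  shows "(LINT w|lborel. dbar f w / (w - z)) = - of_real cauchy_mass * f z"
proof -
  have fd: "f differentiable (at w)" for w using f by simp
  note T = partials_translate[OF fd]
  have cx: "continuous_on UNIV (partial_x f)" and cy: "continuous_on UNIV (partial_y f)" using f by simp_all
  have [measurable]: "dbar f \<in> borel_measurable borel"
    using cx cy unfolding dbar_def by (intro borel_measurable_continuous_onI continuous_intros) auto
  have "C_fun 1 (\<lambda>s. f (z + s))"
    using T(3) by (auto simp: T(1,2)[abs_def] intro!: continuous_on_compose2[OF cx] continuous_on_compose2[OF cy] continuous_intros)
  moreover have "f (z + s) = 0" if "R + cmod z \<le> cmod s" for s
    using that supp[of "z + s"] norm_triangle_ineq4[of "z + s" z] by simp
  ultimately have "(LINT s|lborel. dbar (\<lambda>s. f (z + s)) s / s) = - of_real cauchy_mass * f (z + 0)"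
    using cauchy_pompeiu_0[of "\<lambda>s. f (z + s)" "R + cmod z"] by blast
  moreover have "dbar (\<lambda>s. f (z + s)) s = dbar f (z + s)" for s
    by (simp add: dbar_def T)
  moreover have "(LINT w|lborel. dbar f w / (w - z)) = (LINT s|lborel. dbar f (z + s) / s)"
    using lborel_integral_complex_affine[of 1 "\<lambda>w. dbar f w / (w - z)" z] by simp
  ultimately show ?thesis by simp
qed

section \<open>Orthogonality to polynomials\<close>

lemma borel_representative:
  fixes f :: "complex \<Rightarrow> complex"
  assumes "f \<in> borel_measurable lebesgue"
  obtains g where "g \<in> borel_measurable borel" "AE z in lborel. f z = g z"
proof -
  have "(\<lambda>z. Re (f z)) \<in> borel_measurable lebesgue" "(\<lambda>z. Im (f z)) \<in> borel_measurable lebesgue"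
    using assms by simp_all
  from this[THEN completion_ex_borel_measurable_real]
  obtain u v where [measurable]: "u \<in> borel_measurable lborel" "v \<in> borel_measurable lborel"
    and ae: "AE z in lborel. Re (f z) = u z" "AE z in lborel. Im (f z) = v z"
    by blast
  show ?thesis
  proof
    show "(\<lambda>z. of_real (u z) + \<i> * of_real (v z)) \<in> borel_measurable borel" by measurable
    show "AE z in lborel. f z = of_real (u z) + \<i> * of_real (v z)"
      using ae by eventually_elim (simp add: complex_eq_iff)
  qed
qed

text \<open>Replacing a Lebesgue measurable function by a Borel representative keeps all its pairings with Borel
functions; Fubini's theorem can then be used for \<^const>\<open>lborel\<close>.\<close>

lemma lebesgue_borel_product:
  fixes f g \<psi> :: "complex \<Rightarrow> complex"
  assumes f: "f \<in> borel_measurable lebesgue" and g [measurable]: "g \<in> borel_measurable borel"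
    and ae: "AE z in lborel. f z = g z" and \<psi> [measurable]: "\<psi> \<in> borel_measurable borel"
  shows "integrable lebesgue (\<lambda>z. f z * \<psi> z) \<longleftrightarrow> integrable lborel (\<lambda>z. g z * \<psi> z)"
    and "pairing f \<psi> = (LINT z|lborel. g z * \<psi> z)"
proof -
  have ae': "AE z in lebesgue. f z * \<psi> z = g z * \<psi> z"
    using AE_completion[OF ae] by eventually_elim simp
  have m: "\<psi> \<in> borel_measurable lebesgue" "g \<in> borel_measurable lebesgue"
    using \<psi> g by (auto intro: measurable_completion)
  have m1: "(\<lambda>z. f z * \<psi> z) \<in> borel_measurable lebesgue" "(\<lambda>z. g z * \<psi> z) \<in> borel_measurable lebesgue"
    using f m by simp_all
  have m2: "(\<lambda>z. g z * \<psi> z) \<in> borel_measurable lborel" by measurable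
  show "integrable lebesgue (\<lambda>z. f z * \<psi> z) \<longleftrightarrow> integrable lborel (\<lambda>z. g z * \<psi> z)"
    using integrable_cong_AE[OF m1 ae'] integrable_completion[OF m2] by simp
  show "pairing f \<psi> = (LINT z|lborel. g z * \<psi> z)"
    unfolding pairing_def using integral_cong_AE[OF m1 ae'] integral_completion[OF m2] by simp
qed

lemma exp_linear_le_gauss:
  fixes a b r :: real
  assumes "a > 0"
  shows "exp (b * r) \<le> exp (b\<^sup>2 / (4 * a)) * exp (a * r\<^sup>2)"
proof -
  have "0 \<le> (2 * a * r - b)\<^sup>2 / (4 * a)" using assms by simp
  also have "\<dots> = a * r\<^sup>2 + b\<^sup>2 / (4 * a) - b * r"
    using assms by (simp add: power2_diff field_simps power2_eq_square)
  finally show ?thesis by (simp add: exp_add[symmetric])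
qed

lemma integrable_gauss_moment:
  fixes h :: "complex \<Rightarrow> complex"
  assumes a: "a > 0" and [measurable]: "h \<in> borel_measurable borel"
    and int: "integrable lborel (\<lambda>z. cmod (h z) * exp (a * (cmod z)\<^sup>2))"
    and g [measurable]: "g \<in> borel_measurable borel" and le: "\<And>z. cmod (g z) \<le> C * exp (a * (cmod z)\<^sup>2)"
  shows "integrable lborel (\<lambda>z. h z * g z)"
proof (rule Bochner_Integration.integrable_bound)
  show "integrable lborel (\<lambda>z. C * (cmod (h z) * exp (a * (cmod z)\<^sup>2)))" using int by simp
  show "AE z in lborel. norm (h z * g z) \<le> norm (C * (cmod (h z) * exp (a * (cmod z)\<^sup>2)))"
  proof (rule AE_I2)
    fix z
    have "norm (h z * g z) \<le> cmod (h z) * (C * exp (a * (cmod z)\<^sup>2))"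
      unfolding norm_mult by (intro mult_left_mono le) auto
    then show "norm (h z * g z) \<le> norm (C * (cmod (h z) * exp (a * (cmod z)\<^sup>2)))" by (simp add: mult_ac)
  qed
qed measurable

text \<open>The difference quotient is an entire function of \<open>z\<close> of exponential type. Its Taylor polynomials at \<open>w\<close>
are annihilated by \<open>h\<close> and dominated by \<open>\<bar>b\<bar> exp (\<bar>b\<bar> \<bar>z - w\<bar>)\<close>, which is integrable against \<open>h\<close>
because any Gaussian beats it. So the limit is annihilated too.\<close>

lemma orthogonal_to_difference_quotient:
  fixes h :: "complex \<Rightarrow> complex"
  assumes a: "a > 0" and hm [measurable]: "h \<in> borel_measurable borel"
    and int: "integrable lborel (\<lambda>z. cmod (h z) * exp (a * (cmod z)\<^sup>2))"
    and orth: "\<And>k. (LINT z|lborel. h z * z ^ k) = 0"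
  shows "integrable lborel (\<lambda>z. h z * ((exp (b * (z - w)) - 1) / (z - w)))"
    and "(LINT z|lborel. h z * ((exp (b * (z - w)) - 1) / (z - w))) = 0"
proof -
  have int_pow: "integrable lborel (\<lambda>z. h z * z ^ k)" for k
  proof -
    obtain K where "\<And>r. r \<ge> 0 \<Longrightarrow> r ^ k \<le> K * exp (a * r\<^sup>2)"
      using power_le_exp_square[OF a, of k] by auto
    then show ?thesis
      by (intro integrable_gauss_moment[OF a hm int, of _ K]) (auto simp: norm_power)
  qed
  have shifted: "h z * (z - w) ^ n = (\<Sum>k\<le>n. of_nat (n choose k) * (- w) ^ (n - k) * (h z * z ^ k))" for z n
    using binomial_ring[of z "- w" n] by (simp add: sum_distrib_left mult_ac)
  have int_sh: "integrable lborel (\<lambda>z. h z * (z - w) ^ n)" for n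
    unfolding shifted by (intro Bochner_Integration.integrable_sum integrable_mult_right int_pow)
  have orth_sh: "(LINT z|lborel. h z * (z - w) ^ n) = 0" for n
    unfolding shifted by (subst Bochner_Integration.integral_sum) (auto intro: int_pow simp: orth)
  define c where "c n = b ^ Suc n / fact (Suc n)" for n
  define S where "S N z = (\<Sum>n<N. c n * (h z * (z - w) ^ n))" for N z
  have S_int: "integrable lborel (S N)" for N
    unfolding S_def by (intro Bochner_Integration.integrable_sum integrable_mult_right int_sh)
  have S_0: "(LINT z|lborel. S N z) = 0" for N
    unfolding S_def by (subst Bochner_Integration.integral_sum) (auto intro: int_sh simp: orth_sh)
  have series: "(\<lambda>n. c n * t ^ n) sums ((exp (b * t) - 1) / t)" if "t \<noteq> 0" for t
  proof -
    have "(\<lambda>n. (b * t) ^ Suc n /\<^sub>R fact (Suc n)) sums (exp (b * t) - 1)"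
      by (rule iffD2[OF sums_Suc_iff[of "\<lambda>n. (b * t) ^ n /\<^sub>R fact n"]]) (use exp_converges[of "b * t"] in simp)
    then have "(\<lambda>n. (b * t) ^ Suc n /\<^sub>R fact (Suc n) / t) sums ((exp (b * t) - 1) / t)"
      by (rule sums_divide)
    moreover have "(b * t) ^ Suc n /\<^sub>R fact (Suc n) / t = c n * t ^ n" for n
    proof -
      have "(b * t) ^ Suc n /\<^sub>R fact (Suc n) = t * (c n * t ^ n)"
        by (simp add: c_def scaleR_conv_of_real power_mult_distrib divide_inverse mult_ac del: fact_Suc)
      then show ?thesis using that by simp
    qed
    ultimately show ?thesis by simp
  qed
  define \<beta> where "\<beta> = cmod b"
  define C where "C = \<beta> * exp (\<beta> * cmod w) * exp (\<beta>\<^sup>2 / (4 * a))"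
  have S_bd: "cmod (S N z) \<le> C * (cmod (h z) * exp (a * (cmod z)\<^sup>2))" for N z
  proof -
    let ?t = "cmod (z - w)"
    have "cmod (S N z) \<le> (\<Sum>n<N. cmod (c n * (h z * (z - w) ^ n)))" unfolding S_def by (rule norm_sum)
    also have "\<dots> \<le> (\<Sum>n<N. \<beta> * cmod (h z) * ((\<beta> * ?t) ^ n / fact n))"
    proof (rule sum_mono)
      fix n
      have "1 / fact (Suc n) \<le> (1 / fact n :: real)"
        by (intro divide_left_mono fact_mono) auto
      then have "\<beta> * cmod (h z) * (\<beta> * ?t) ^ n * (1 / fact (Suc n)) \<le> \<beta> * cmod (h z) * (\<beta> * ?t) ^ n * (1 / fact n)"
        by (intro mult_left_mono) (auto simp: \<beta>_def)
      moreover have "cmod (c n * (h z * (z - w) ^ n)) = \<beta> * cmod (h z) * (\<beta> * ?t) ^ n * (1 / fact (Suc n))"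
        by (simp add: c_def \<beta>_def norm_mult norm_divide norm_power power_mult_distrib mult_ac del: fact_Suc)
      ultimately show "cmod (c n * (h z * (z - w) ^ n)) \<le> \<beta> * cmod (h z) * ((\<beta> * ?t) ^ n / fact n)" by simp
    qed
    also have "\<dots> = \<beta> * cmod (h z) * (\<Sum>n<N. (\<beta> * ?t) ^ n /\<^sub>R fact n)"
      by (simp add: sum_distrib_left divide_inverse mult_ac)
    also have "\<dots> \<le> \<beta> * cmod (h z) * exp (\<beta> * ?t)"
      unfolding exp_def by (intro mult_left_mono sum_le_suminf summable_exp_generic) (auto simp: \<beta>_def)
    also have "\<dots> \<le> \<beta> * cmod (h z) * (exp (\<beta> * cmod w) * (exp (\<beta>\<^sup>2 / (4 * a)) * exp (a * (cmod z)\<^sup>2)))"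
    proof (rule mult_left_mono)
      have "\<beta> * ?t \<le> \<beta> * (cmod w + cmod z)"
        using norm_triangle_ineq4[of z w] by (intro mult_left_mono) (auto simp: \<beta>_def)
      then have "exp (\<beta> * ?t) \<le> exp (\<beta> * cmod w) * exp (\<beta> * cmod z)"
        by (simp add: exp_add[symmetric] algebra_simps)
      also have "\<dots> \<le> exp (\<beta> * cmod w) * (exp (\<beta>\<^sup>2 / (4 * a)) * exp (a * (cmod z)\<^sup>2))"
        by (intro mult_left_mono exp_linear_le_gauss a) auto
      finally show "exp (\<beta> * ?t) \<le> exp (\<beta> * cmod w) * (exp (\<beta>\<^sup>2 / (4 * a)) * exp (a * (cmod z)\<^sup>2))" .
    qed (simp add: \<beta>_def)
    finally show ?thesis by (simp only: C_def mult_ac)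
  qed
  let ?G = "\<lambda>z. h z * ((exp (b * (z - w)) - 1) / (z - w))"
  have Gm: "?G \<in> borel_measurable lborel"
  proof -
    have [measurable]: "(\<lambda>z. exp (b * (z - w)) - 1) \<in> borel_measurable borel"
      by (intro borel_measurable_continuous_onI continuous_intros)
    show ?thesis by measurable
  qed
  have wint: "integrable lborel (\<lambda>z. C * (cmod (h z) * exp (a * (cmod z)\<^sup>2)))" using int by simp
  have Sm: "S N \<in> borel_measurable lborel" for N
    using borel_measurable_integrable[OF S_int] .
  have lim: "AE z in lborel. (\<lambda>N. S N z) \<longlonglongrightarrow> ?G z"
    using AE_lborel_singleton[of w]
  proof eventually_elim
    case (elim z)
    then have "(\<lambda>n. h z * (c n * (z - w) ^ n)) sums ?G z"
      by (intro sums_mult series) simp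
    then show ?case by (simp add: S_def sums_def mult_ac)
  qed
  have bd: "AE z in lborel. norm (S N z) \<le> C * (cmod (h z) * exp (a * (cmod z)\<^sup>2))" for N
    using S_bd by simp
  show "integrable lborel ?G"
    by (rule integrable_dominated_convergence[OF Gm Sm wint lim bd])
  have "(\<lambda>N. LINT z|lborel. S N z) \<longlonglongrightarrow> (LINT z|lborel. ?G z)"
    by (rule integral_dominated_convergence[OF Gm Sm wint lim bd])
  then show "(LINT z|lborel. ?G z) = 0" using S_0 by (simp add: LIMSEQ_const_iff)
qed

text \<open>Orthogonality to polynomials makes the twisted kernel and the Cauchy kernel indistinguishable to \<open>h\<close>. The
identity holds at every \<open>w\<close>: the two integrands differ by an integrable function, so either both integrals
converge or both have the default value \<open>0\<close>.\<close>

lemma cauchy_transform_twist: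
  fixes h :: "complex \<Rightarrow> complex"
  assumes a: "a > 0" and hm [measurable]: "h \<in> borel_measurable borel"
    and int: "integrable lborel (\<lambda>z. cmod (h z) * exp (a * (cmod z)\<^sup>2))"
    and orth: "\<And>k. (LINT z|lborel. h z * z ^ k) = 0"
  shows "(LINT z|lborel. h z * (exp (b * (z - w)) / (z - w))) = (LINT z|lborel. h z * (1 / (z - w)))"
proof -
  note D = orthogonal_to_difference_quotient[OF assms, where b = b and w = w]
  have eq: "h z * (exp (b * (z - w)) / (z - w)) = h z * ((exp (b * (z - w)) - 1) / (z - w)) + h z * (1 / (z - w))" for z
    by (simp add: diff_divide_distrib algebra_simps)
  show ?thesis
  proof (cases "integrable lborel (\<lambda>z. h z * (1 / (z - w)))")
    case True
    then show ?thesis unfolding eq using D by simp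
  next
    case False
    have "\<not> integrable lborel (\<lambda>z. h z * (exp (b * (z - w)) / (z - w)))"
    proof
      assume "integrable lborel (\<lambda>z. h z * (exp (b * (z - w)) / (z - w)))"
      from Bochner_Integration.integrable_diff[OF this D(1)]
      show False using False unfolding eq by simp
    qed
    then show ?thesis using False by (simp add: not_integrable_integral_eq)
  qed
qed

section \<open>The Cauchy transform\<close>

definition cauchy_transform :: "(complex \<Rightarrow> complex) \<Rightarrow> complex \<Rightarrow> complex" where
  "cauchy_transform h w = (LINT z|lborel. h z * (1 / (w - z))) / of_real cauchy_mass"

lemma borel_measurable_cauchy_transform [measurable]:
  assumes [measurable]: "h \<in> borel_measurable borel"
  shows "cauchy_transform h \<in> borel_measurable borel"
  unfolding cauchy_transform_def by measurable

text \<open>The substitution \<open>w = z - s\<close>.\<close>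

lemma solve_eq_kernel_integral:
  assumes "continuous_on UNIV f"
  shows "(LINT w|lborel. exp (of_real (2 * a) * cnj w * (z - w)) / (z - w) * f w) = solve a 0 f z"
    and "(LINT w|lborel. cmod (exp (of_real (2 * a) * cnj w * (z - w)) / (z - w) * f w))
      = (LINT s|lborel. cmod (f (z - s) * twisted_kernel a 0 z s))"
    and "integrable lborel (\<lambda>s. f (z - s) * twisted_kernel a 0 z s) \<Longrightarrow>
      integrable lborel (\<lambda>w. exp (of_real (2 * a) * cnj w * (z - w)) / (z - w) * f w)"
proof -
  let ?g = "\<lambda>w. exp (of_real (2 * a) * cnj w * (z - w)) / (z - w) * f w"
  have [measurable]: "f \<in> borel_measurable borel"
    using assms by (rule borel_measurable_continuous_onI)
  have [measurable]: "(\<lambda>w. exp (of_real (2 * a) * cnj w * (z - w))) \<in> borel_measurable borel"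
    by (intro borel_measurable_continuous_onI continuous_intros)
  have gm [measurable]: "?g \<in> borel_measurable borel" by measurable
  have gm2: "(\<lambda>w. complex_of_real (cmod (?g w))) \<in> borel_measurable borel" by measurable
  have eq: "?g (z + of_real (- 1) * s) = f (z - s) * twisted_kernel a 0 z s" for s
    by (simp add: twisted_kernel_def)
  show "(LINT w|lborel. ?g w) = solve a 0 f z"
    using lborel_integral_complex_affine[OF _ gm, of "- 1" z] unfolding eq by (simp add: solve_def)
  have "(LINT w|lborel. complex_of_real (cmod (?g w)))
      = (LINT s|lborel. complex_of_real (cmod (f (z - s) * twisted_kernel a 0 z s)))"
    using lborel_integral_complex_affine[OF _ gm2, of "- 1" z] unfolding eq by simp
  then show "(LINT w|lborel. cmod (?g w)) = (LINT s|lborel. cmod (f (z - s) * twisted_kernel a 0 z s))"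
    by (simp only: integral_complex_of_real of_real_eq_iff)
  show "integrable lborel ?g" if "integrable lborel (\<lambda>s. f (z - s) * twisted_kernel a 0 z s)"
  proof -
    have "integrable lborel (\<lambda>w. f (z - (z + of_real (- 1) * w)) * twisted_kernel a 0 z (z + of_real (- 1) * w))"
      by (rule lborel_integrable_complex_affine[OF _ that]) simp
    then show ?thesis by (simp add: twisted_kernel_def mult_ac)
  qed
qed

text \<open>The Cauchy transform is the negative transpose of the solution operator divided by \<open>\<pi>\<close>. Here the twist for the variable
\<open>w\<close> uses \<open>b = 2 a cnj w\<close>, which depends on \<open>w\<close> in a non-holomorphic way but is constant in \<open>z\<close>.\<close>

lemma cauchy_transform_pairing:
  fixes h :: "complex \<Rightarrow> complex"
  assumes a: "a > 0" and hm [measurable]: "h \<in> borel_measurable borel"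
    and int: "integrable lborel (\<lambda>z. cmod (h z) * exp (a * (cmod z)\<^sup>2))"
    and orth: "\<And>k. (LINT z|lborel. h z * z ^ k) = 0"
    and f: "continuous_on UNIV f" "\<And>w. cmod (f w) \<le> M * exp (a * (cmod w)\<^sup>2)"
  shows "integrable lborel (\<lambda>w. cauchy_transform h w * f w)"
    and "(LINT w|lborel. cauchy_transform h w * f w) = - (LINT z|lborel. h z * solve a 0 f z) / of_real cauchy_mass"
proof -
  define K where "K z w = exp (of_real (2 * a) * cnj w * (z - w)) / (z - w)" for z w
  have K: "cauchy_transform h w = - (LINT z|lborel. h z * K z w) / of_real cauchy_mass" for w
  proof -
    have "(LINT z|lborel. h z * K z w) = (LINT z|lborel. h z * (1 / (z - w)))"
      unfolding K_def by (rule cauchy_transform_twist[OF a hm int orth])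
    also have "\<dots> = (LINT z|lborel. - (h z * (1 / (w - z))))"
    proof (rule arg_cong[where f = "integral\<^sup>L lborel"], rule ext)
      fix z
      have "z - w = - (w - z)" by simp
      then show "h z * (1 / (z - w)) = - (h z * (1 / (w - z)))" by (simp only: divide_minus_right mult_minus_right)
    qed
    finally show ?thesis by (simp add: cauchy_transform_def)
  qed
  have fm: "f \<in> borel_measurable borel" using f(1) by (rule borel_measurable_continuous_onI)
  have Km: "(\<lambda>(z, w). K z w) \<in> borel_measurable (borel \<Otimes>\<^sub>M borel)"
  proof -
    have "(\<lambda>p::complex \<times> complex. exp (of_real (2 * a) * cnj (snd p) * (fst p - snd p))) \<in> borel_measurable borel"
      by (intro borel_measurable_continuous_onI continuous_intros)
    then have [measurable]: "(\<lambda>p::complex \<times> complex. exp (of_real (2 * a) * cnj (snd p) * (fst p - snd p)))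
        \<in> borel_measurable (borel \<Otimes>\<^sub>M borel)" by (simp add: borel_prod)
    show ?thesis unfolding K_def split_beta by measurable
  qed
  define A where "A = M * (LINT s|lborel. gauss_kernel a 0 s)"
  note I = integrable_solve_integrand[OF a f, of _ 0]
  have i1: "integrable lborel (\<lambda>w. K z w * f w)" for z
    unfolding K_def using solve_eq_kernel_integral(3)[OF f(1) I] .
  have i2: "(LINT w|lborel. cmod (K z w * f w)) \<le> A * exp (a * (cmod z)\<^sup>2)" for z
    unfolding K_def A_def solve_eq_kernel_integral(2)[OF f(1)]
    using integral_norm_solve_integrand[OF a f, of z 0] .
  have i3: "integrable lborel (\<lambda>z. cmod (h z) * (A * exp (a * (cmod z)\<^sup>2)))"
    using integrable_mult_right[OF int, of A] by (simp add: mult_ac)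
  note T = kernel_transpose[OF hm fm Km i1 i2 i3]
  have eq: "cauchy_transform h w * f w = (- 1 / of_real cauchy_mass) * ((LINT z|lborel. h z * K z w) * f w)" for w
    by (simp add: K)
  show "integrable lborel (\<lambda>w. cauchy_transform h w * f w)"
    unfolding eq using T(1) by (rule integrable_mult_right)
  show "(LINT w|lborel. cauchy_transform h w * f w) = - (LINT z|lborel. h z * solve a 0 f z) / of_real cauchy_mass"
    unfolding eq integral_mult_right_zero T(2) unfolding K_def solve_eq_kernel_integral(1)[OF f(1)] by simp
qed

text \<open>The transpose of the Cauchy-Pompeiu formula. Fubini needs a bound for \<open>\<integral> \<bar>\<partial>\<close>-bar \<open>f(w)\<bar> / \<bar>w - z\<bar>\<close> in terms of \<open>z\<close>;
as \<open>f\<close> has compact support, a bound by a multiple of \<open>exp (a \<bar>z\<bar>\<^sup>2)\<close> is available and matches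
the integrability of \<open>h\<close>.\<close>

lemma cauchy_transform_dbar:
  fixes h :: "complex \<Rightarrow> complex"
  assumes a: "a > 0" and hm [measurable]: "h \<in> borel_measurable borel"
    and int: "integrable lborel (\<lambda>z. cmod (h z) * exp (a * (cmod z)\<^sup>2))"
    and f: "C_fun 1 f" and supp: "\<And>z. R \<le> cmod z \<Longrightarrow> f z = 0"
  shows "(LINT w|lborel. cauchy_transform h w * dbar f w) = - (LINT z|lborel. h z * f z)"
proof -
  have cd: "continuous_on UNIV (dbar f)"
    using f unfolding dbar_def by (auto intro!: continuous_intros)
  have dm [measurable]: "dbar f \<in> borel_measurable borel" using cd by (rule borel_measurable_continuous_onI)
  have d0: "dbar f z = 0" if "R < cmod z" for z
    using partials_zero_outside[of R f, OF supp that] by (simp add: dbar_def)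
  obtain M where M: "M \<ge> 0" "\<And>z. cmod (dbar f z) \<le> M"
    using bounded_compact_support[OF cd d0] by blast
  define M' where "M' = M * exp (a * R\<^sup>2)"
  have M': "cmod (dbar f w) \<le> M' * exp (- a * (cmod w)\<^sup>2)" for w
  proof (cases "R < cmod w")
    case True
    then show ?thesis using d0 M(1) by (simp add: M'_def)
  next
    case False
    then have "(cmod w)\<^sup>2 \<le> R\<^sup>2" by (intro power_mono) auto
    then have "1 \<le> exp (a * R\<^sup>2) * exp (- a * (cmod w)\<^sup>2)"
      using a by (simp add: exp_add[symmetric])
    then have "M * 1 \<le> M * (exp (a * R\<^sup>2) * exp (- a * (cmod w)\<^sup>2))" using M(1) by (intro mult_left_mono)
    then show ?thesis using M(2)[of w] by (simp add: M'_def mult.assoc)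
  qed
  have M'0: "M' \<ge> 0" using M(1) by (simp add: M'_def)
  have bd: "cmod (dbar f (z + s) / s) \<le> M' * exp (a * (cmod z)\<^sup>2) * gauss_kernel (a / 2) 0 s" for z s
  proof -
    \<comment> \<open>Half of the exponent pays for moving the centre of the Gaussian from \<open>- z\<close> to \<open>0\<close>.\<close>
    have "cmod s \<le> cmod (z + s) + cmod z" using norm_triangle_ineq4[of "z + s" z] by simp
    then have "(cmod s)\<^sup>2 \<le> (cmod (z + s) + cmod z)\<^sup>2" by (intro power_mono) auto
    also have "\<dots> \<le> 2 * (cmod (z + s))\<^sup>2 + 2 * (cmod z)\<^sup>2"
      using zero_le_power2[of "cmod (z + s) - cmod z"] by (simp add: power2_sum power2_diff)
    finally have "a / 2 * (cmod s)\<^sup>2 \<le> a / 2 * (2 * (cmod (z + s))\<^sup>2 + 2 * (cmod z)\<^sup>2)"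
      using a by (intro mult_left_mono) auto
    then have "- a * (cmod (z + s))\<^sup>2 \<le> a * (cmod z)\<^sup>2 + - (a / 2) * (cmod s)\<^sup>2"
      by (simp add: algebra_simps)
    then have "exp (- a * (cmod (z + s))\<^sup>2) \<le> exp (a * (cmod z)\<^sup>2) * exp (- (a / 2) * (cmod s)\<^sup>2)"
      unfolding exp_add[symmetric] by simp
    then have "M' * exp (- a * (cmod (z + s))\<^sup>2) \<le> M' * (exp (a * (cmod z)\<^sup>2) * exp (- (a / 2) * (cmod s)\<^sup>2))"
      using M'0 by (intro mult_left_mono)
    with M'[of "z + s"] have "cmod (dbar f (z + s)) \<le> M' * (exp (a * (cmod z)\<^sup>2) * exp (- (a / 2) * (cmod s)\<^sup>2))"
      by (rule order_trans)
    then have "cmod (dbar f (z + s)) / cmod s \<le> M' * (exp (a * (cmod z)\<^sup>2) * exp (- (a / 2) * (cmod s)\<^sup>2)) / cmod s"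
      by (intro divide_right_mono) auto
    then show ?thesis by (simp add: gauss_kernel_def norm_divide mult.assoc)
  qed
  have gk: "integrable lborel (gauss_kernel (a / 2) 0)" using a by (intro integrable_gauss_kernel) simp
  define A where "A = M' * (LINT s|lborel. gauss_kernel (a / 2) 0 s)"
  have int_s: "integrable lborel (\<lambda>s. dbar f (z + s) / s)" for z
  proof (rule Bochner_Integration.integrable_bound)
    show "integrable lborel (\<lambda>s. M' * exp (a * (cmod z)\<^sup>2) * gauss_kernel (a / 2) 0 s)" using gk by simp
    show "AE s in lborel. norm (dbar f (z + s) / s) \<le> norm (M' * exp (a * (cmod z)\<^sup>2) * gauss_kernel (a / 2) 0 s)"
      using bd M'0 by (intro AE_I2) (simp add: abs_mult gauss_kernel_nonneg)
  qed measurable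
  have Km: "(\<lambda>(z, w). 1 / (w - z)) \<in> borel_measurable (borel \<Otimes>\<^sub>M (borel :: complex measure))"
    by measurable
  have i1: "integrable lborel (\<lambda>w. 1 / (w - z) * dbar f w)" for z
    using lborel_integrable_complex_affine[OF _ int_s, of 1 z "- z"] by simp
  have i2: "(LINT w|lborel. cmod (1 / (w - z) * dbar f w)) \<le> A * exp (a * (cmod z)\<^sup>2)" for z
  proof -
    have "(LINT w|lborel. complex_of_real (cmod (1 / (w - z) * dbar f w)))
        = (LINT s|lborel. complex_of_real (cmod (dbar f (z + s) / s)))"
      using lborel_integral_complex_affine[of 1 "\<lambda>w. complex_of_real (cmod (1 / (w - z) * dbar f w))" z] by simp
    then have "(LINT w|lborel. cmod (1 / (w - z) * dbar f w)) = (LINT s|lborel. cmod (dbar f (z + s) / s))"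
      by (simp only: integral_complex_of_real of_real_eq_iff)
    also have "\<dots> \<le> (LINT s|lborel. M' * exp (a * (cmod z)\<^sup>2) * gauss_kernel (a / 2) 0 s)"
      using int_s gk by (intro integral_mono bd) auto
    finally show ?thesis by (simp add: A_def mult_ac)
  qed
  have i3: "integrable lborel (\<lambda>z. cmod (h z) * (A * exp (a * (cmod z)\<^sup>2)))"
    using integrable_mult_right[OF int, of A] by (simp add: mult_ac)
  have "(LINT w|lborel. (LINT z|lborel. h z * (1 / (w - z))) * dbar f w)
      = (LINT z|lborel. h z * (LINT w|lborel. 1 / (w - z) * dbar f w))"
    by (rule kernel_transpose(2)[OF hm dm Km i1 i2 i3])
  also have "\<dots> = (LINT z|lborel. - of_real cauchy_mass * (h z * f z))"
    using cauchy_pompeiu[OF f supp] by (simp add: mult_ac)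
  also have "\<dots> = - of_real cauchy_mass * (LINT z|lborel. h z * f z)" by (rule integral_mult_right_zero)
  finally have "(LINT w|lborel. (LINT z|lborel. h z * (1 / (w - z))) * dbar f w)
      = - of_real cauchy_mass * (LINT z|lborel. h z * f z)" .
  moreover have "cauchy_transform h w * dbar f w =
      (1 / of_real cauchy_mass) * ((LINT z|lborel. h z * (1 / (w - z))) * dbar f w)" for w
    by (simp add: cauchy_transform_def)
  ultimately show ?thesis using cauchy_mass_pos by simp
qed

section \<open>Solving the inhomogeneous Cauchy-Riemann equation in the dual space\<close>

lemma test_function_support:
  assumes "test_function \<phi>"
  obtains R where "\<And>z. R \<le> cmod z \<Longrightarrow> \<phi> z = 0"
proof -
  have "compact (closure {z. \<phi> z \<noteq> 0})" using assms unfolding test_function_def by (rule conjunct2)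
  then have "bounded {z. \<phi> z \<noteq> 0}" by (rule bounded_subset[OF compact_imp_bounded closure_subset])
  then obtain R where R: "\<And>z. \<phi> z \<noteq> 0 \<Longrightarrow> cmod z \<le> R"
    unfolding bounded_iff by blast
  show ?thesis
  proof (rule that)
    show "\<phi> z = 0" if "R + 1 \<le> cmod z" for z
      using R[of z] that by fastforce
  qed
qed

text \<open>With \<open>u\<close> the Cauchy transform, the pairing of \<open>u\<close> with \<open>\<psi>\<close> is, up to the factor \<open>- 1 / \<pi>\<close>, the pairing of \<open>h\<close>
with \<open>solve q1 0 \<psi>\<close>, whose norm in \<open>\<Lambda>\<^bsub>q,l\<^esub>\<close> is controlled because \<open>q / e < q\<close>.\<close>

theorem theorem4p2:
  fixes q q1 :: real and l :: nat
  assumes "q > 0" and "q1 \<in> {0<..<q / exp 1}"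
  shows "\<exists>C::real. \<forall>h::complex \<Rightarrow> complex.
           fun_in_dual q l h \<longrightarrow> (\<forall>k::nat. pairing h (\<lambda>z. z ^ k) = 0) \<longrightarrow>
           (\<exists>u::complex \<Rightarrow> complex.
              fun_in_dual q1 l u \<and> dbar_distributional u h \<and>
              Lam_dual_norm q1 l (pairing u) \<le> C * Lam_dual_norm q l (pairing h) \<and>
              (\<forall>\<psi>\<in>Lam q1 l.
                 cmod (pairing u \<psi>) \<le> C * Lam_dual_norm q l (pairing h) * Lam_norm q1 l \<psi>))"
proof -
  have q1: "0 < q1" using assms(2) by simp
  have "q / exp 1 < q" using assms(1) by (simp add: divide_less_eq)
  then have q1q: "q1 < q" using assms(2) by simp
  obtain C0 where C0: "C0 \<ge> 0"
    "\<And>M f. gauss_bounded q1 l M f \<Longrightarrow> gauss_bounded q1 l (C0 * M) (solve q1 0 f)"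
    using solve_gauss_bounded[OF q1, of l 0] by blast
  define C where "C = C0 / cauchy_mass"
  have C: "C \<ge> 0" using C0(1) cauchy_mass_pos by (simp add: C_def)
  show ?thesis
  proof (intro exI[of _ C] allI impI)
    fix h assume h: "fun_in_dual q l h" and orth: "\<forall>k::nat. pairing h (\<lambda>z. z ^ k) = 0"
    have hdual: "pairing h \<in> Lam_dual q l"
      and hint: "\<And>\<psi>. \<psi> \<in> Lam q l \<Longrightarrow> integrable lebesgue (\<lambda>z. h z * \<psi> z)"
      using h by (auto simp: fun_in_dual_def)
    have "h \<in> borel_measurable lebesgue"
      using hint[OF gauss_in_Lam[of 0 q l]] assms(1) by (simp add: borel_measurable_integrable)
    note hmeas = this
    obtain g where g [measurable]: "g \<in> borel_measurable borel" and ae: "AE z in lborel. h z = g z"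
      using borel_representative[OF hmeas] by blast
    note prod = lebesgue_borel_product[OF hmeas g ae]
    have gint: "integrable lborel (\<lambda>z. cmod (g z) * exp (q1 * (cmod z)\<^sup>2))"
    proof -
      have "integrable lborel (\<lambda>z. g z * of_real (exp (q1 * (cmod z)\<^sup>2)))"
        using hint[OF gauss_in_Lam[OF q1q]] by (subst (asm) prod(1)) measurable
      from integrable_norm[OF this] show ?thesis by (simp add: norm_mult)
    qed
    have gorth: "(LINT z|lborel. g z * z ^ k) = 0" for k
      using orth[rule_format, of k] by (subst (asm) prod(2)) measurable
    define u where "u = cauchy_transform g"
    have um [measurable]: "u \<in> borel_measurable borel" unfolding u_def by measurable
    have up: "pairing u f = (LINT w|lborel. u w * f w)"
      "integrable lebesgue (\<lambda>z. u z * f z) \<longleftrightarrow> integrable lborel (\<lambda>z. u z * f z)"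
      if [measurable]: "f \<in> borel_measurable borel" for f
      unfolding pairing_def by (intro integral_completion integrable_completion; measurable)+
    have U: "integrable lebesgue (\<lambda>z. u z * \<psi> z)"
      "cmod (pairing u \<psi>) \<le> C * Lam_dual_norm q l (pairing h) * Lam_norm q1 l \<psi>"
      if \<psi>: "\<psi> \<in> Lam q1 l" for \<psi>
    proof -
      note gb = Lam_imp_gauss_bounded[OF \<psi>]
      note cont = gauss_bounded_continuous[OF gb]
      note tr = cauchy_transform_pairing[OF q1 g gint gorth cont gauss_boundedD[OF gb], folded u_def]
      have \<psi>m: "\<psi> \<in> borel_measurable borel" using cont by (rule borel_measurable_continuous_onI)
      show "integrable lebesgue (\<lambda>z. u z * \<psi> z)" using tr(1) up(2)[OF \<psi>m] by simp
      note sb = C0(2)[OF gb]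
      note sL = gauss_bounded_imp_Lam[OF sb q1q]
      have sm: "solve q1 0 \<psi> \<in> borel_measurable borel"
        using gauss_bounded_continuous[OF sb] by (rule borel_measurable_continuous_onI)
      have "pairing u \<psi> = - pairing h (solve q1 0 \<psi>) / of_real cauchy_mass"
        unfolding up(1)[OF \<psi>m] tr(2) prod(2)[OF sm] ..
      then have "cmod (pairing u \<psi>) = cmod (pairing h (solve q1 0 \<psi>)) / cauchy_mass"
        using cauchy_mass_pos by (simp add: norm_divide)
      also have "\<dots> \<le> Lam_dual_norm q l (pairing h) * Lam_norm q l (solve q1 0 \<psi>) / cauchy_mass"
        using cauchy_mass_pos by (intro divide_right_mono Lam_dual_bound[OF hdual sL(1)]) simp
      also have "\<dots> \<le> Lam_dual_norm q l (pairing h) * (C0 * Lam_norm q1 l \<psi>) / cauchy_mass"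
        using cauchy_mass_pos Lam_dual_norm_nonneg[OF hdual]
        by (intro divide_right_mono mult_left_mono sL(2)) auto
      finally show "cmod (pairing u \<psi>) \<le> C * Lam_dual_norm q l (pairing h) * Lam_norm q1 l \<psi>"
        by (simp add: C_def mult_ac)
    qed
    have dual: "pairing u \<in> Lam_dual q1 l"
      unfolding Lam_dual_def
    proof (intro CollectI conjI ballI allI)
      show "pairing u (\<lambda>z. \<phi> z + \<psi> z) = pairing u \<phi> + pairing u \<psi>"
        if "\<phi> \<in> Lam q1 l" "\<psi> \<in> Lam q1 l" for \<phi> \<psi>
        using U(1)[OF that(1)] U(1)[OF that(2)] by (simp add: pairing_def distrib_left)
      show "pairing u (\<lambda>z. c * \<psi> z) = c * pairing u \<psi>" for c \<psi>
        by (simp add: pairing_def mult.left_commute)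
      show "\<exists>C. \<forall>\<psi>\<in>Lam q1 l. cmod (pairing u \<psi>) \<le> C * Lam_norm q1 l \<psi>"
        using U(2) by blast
    qed
    have "integrable lebesgue u"
      using U(1)[OF gauss_in_Lam[OF q1, of l]] by simp
    then have "locally_integrable u"
      unfolding locally_integrable_def set_integrable_def
      by (intro allI impI integrable_mult_indicator) (auto intro: fmeasurableD lmeasurable_compact)
    then have 1: "fun_in_dual q1 l u"
      using U(1) dual by (auto simp: fun_in_dual_def)
    have 2: "dbar_distributional u h"
      unfolding dbar_distributional_def
    proof (intro allI impI)
      fix \<phi> assume \<phi>: "test_function \<phi>"
      obtain R where R: "\<And>z. R \<le> cmod z \<Longrightarrow> \<phi> z = 0" using test_function_support[OF \<phi>] by blast
      have C1: "C_fun 1 \<phi>" using \<phi> by (simp add: test_function_def del: C_fun.simps)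
      then have cont: "continuous_on UNIV \<phi>" "continuous_on UNIV (dbar \<phi>)"
        using C_fun_continuous[OF C1] by (auto simp: dbar_def intro!: continuous_intros)
      note m = cont[THEN borel_measurable_continuous_onI]
      show "- pairing u (dbar \<phi>) = pairing h \<phi>"
        using cauchy_transform_dbar[of q1 g \<phi> R, OF q1 g gint C1 R, folded u_def]
        by (simp add: up(1)[OF m(2)] prod(2)[OF m(1)])
    qed
    have 3: "Lam_dual_norm q1 l (pairing u) \<le> C * Lam_dual_norm q l (pairing h)"
      unfolding Lam_dual_norm_def[of q1]
    proof (rule cSUP_least)
      show "{\<psi> \<in> Lam q1 l. Lam_norm q1 l \<psi> \<le> 1} \<noteq> {}"
        using zero_in_Lam[where q = q1 and l = l] by fastforce
      fix \<psi> assume "\<psi> \<in> {\<psi> \<in> Lam q1 l. Lam_norm q1 l \<psi> \<le> 1}"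
      then have \<psi>: "\<psi> \<in> Lam q1 l" "Lam_norm q1 l \<psi> \<le> 1" by auto
      have "C * Lam_dual_norm q l (pairing h) * Lam_norm q1 l \<psi> \<le> C * Lam_dual_norm q l (pairing h)"
        using C Lam_dual_norm_nonneg[OF hdual] \<psi>(2) by (intro mult_left_le) auto
      with U(2)[OF \<psi>(1)] show "cmod (pairing u \<psi>) \<le> C * Lam_dual_norm q l (pairing h)" by simp
    qed
    show "\<exists>u. fun_in_dual q1 l u \<and> dbar_distributional u h \<and>
        Lam_dual_norm q1 l (pairing u) \<le> C * Lam_dual_norm q l (pairing h) \<and>
        (\<forall>\<psi>\<in>Lam q1 l. cmod (pairing u \<psi>) \<le> C * Lam_dual_norm q l (pairing h) * Lam_norm q1 l \<psi>)"
      using 1 2 3 U(2) by blast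
  qed
qed

end
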